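(* Let $\underline{\lambda}$ be a tuple of partitions. The space $\mathbf{A}^{\underline{\lambda}}$ admits a $\mathrm{GL}$-generic $K$-point if and only if $\underline{\lambda}$ is pure.
   Context: $K$ is a field of characteristic $0$. $\mathrm{GL}=\bigcup_{n\ge1}\mathrm{GL}_n(K)$ (a discrete group) and $\mathbf{V}=\bigcup_{n\ge1}K^n$ is its standard representation. For a partition $\lambda$, $\mathbf{V}_\lambda=\mathbf{S}_\lambda(\mathbf{V})$ with $\mathbf{S}_\lambda$ the Schur functor. A tuple is a finite tuple $\underline{\lambda}=[\lambda_1,\dots,\lambda_r]$ of partitions; it is pure if it does not contain the empty partition. $\mathbf{A}^{\underline{\lambda}}=\mathrm{Spec}(\mathrm{Sym}(\bigoplus_i\mathbf{V}_{\lambda_i}))$, an affine scheme with $\mathrm{GL}$-action. For a point $x$ of an affine scheme $X$ with $\mathrm{GL}$-action, the orbit closure $\overline{O}_x$ is the intersection of all closed $\mathrm{GL}$-stable subsets of $X$ containing $x$; $x$ is $\mathrm{GL}$-generic if $\overline{O}_x=X$. *)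

theory Defs
  imports
    "HOL-Library.Poly_Mapping"
    "HOL-Combinatorics.Permutations"
    "HOL-Algebra.QuotRing"
    "HOL-Algebra.Algebraic_Closure_Type"
    "Jordan_Normal_Form.Matrix"
begin

text \<open>
  The field \<open>K\<close> is a type \<open>'a\<close> of class \<^class>\<open>field_char_0\<close>; as a ring with explicit carrier it is
  \<^const>\<open>ring_of_type_algebra\<close>. A \<open>K\<close>-vector space with basis \<open>'i\<close> is the type \<open>'i \<Rightarrow>\<^sub>0 'a\<close>.
\<close>

abbreviation lookup where "lookup \<equiv> Poly_Mapping.lookup"
abbreviation keys where "keys \<equiv> Poly_Mapping.keys"
abbreviation single where "single \<equiv> Poly_Mapping.single"

definition vscale :: "'a \<Rightarrow> ('i \<Rightarrow>\<^sub>0 'a) \<Rightarrow> ('i \<Rightarrow>\<^sub>0 'a::field)" where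
  "vscale c v = Poly_Mapping.map (\<lambda>x. c * x) v"

definition lin_ext :: "('i \<Rightarrow> ('j \<Rightarrow>\<^sub>0 'a)) \<Rightarrow> ('i \<Rightarrow>\<^sub>0 'a) \<Rightarrow> ('j \<Rightarrow>\<^sub>0 'a::field)" where
  "lin_ext b v = (\<Sum>i\<in>keys v. vscale (lookup v i) (b i))"


section \<open>The group GL and its standard representation\<close>

type_synonym 'a stdrep = "nat \<Rightarrow>\<^sub>0 'a"

text \<open>
  The automorphism of \<open>V\<close> given by an \<open>n \<times> n\<close> matrix, fixing the basis vectors \<open>e\<^sub>j\<close> with \<open>j \<ge> n\<close>.
  Passing to the union over \<open>n\<close>, \<open>GL\<close> is realised as a group of automorphisms of \<open>V\<close>.
\<close>

definition gl_map :: "nat \<Rightarrow> 'a mat \<Rightarrow> 'a stdrep \<Rightarrow> 'a::field stdrep" where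
  "gl_map n M = lin_ext (\<lambda>j. if j < n then (\<Sum>i<n. single i (M $$ (i, j))) else single j 1)"

definition GL :: "('a stdrep \<Rightarrow> 'a::field stdrep) set" where
  "GL = (\<Union>n\<in>{1..}. {gl_map n M | M. M \<in> carrier_mat n n \<and> invertible_mat M})"


section \<open>Tensor powers and Schur functors\<close>

text \<open>The list \<open>[j\<^sub>1, \<dots>, j\<^sub>d]\<close> stands for the basis tensor \<open>e\<^sub>j\<^sub>1 \<otimes> \<dots> \<otimes> e\<^sub>j\<^sub>d\<close>.\<close>

type_synonym 'a tensor = "nat list \<Rightarrow>\<^sub>0 'a"

definition tensor_power :: "nat \<Rightarrow> 'a::field tensor set" where
  "tensor_power d = {t. \<forall>js\<in>keys t. length js = d}"

fun pure_tensor :: "'a stdrep list \<Rightarrow> 'a::field tensor" where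
  "pure_tensor [] = single [] 1"
| "pure_tensor (v # vs) =
     (\<Sum>i\<in>keys v. \<Sum>is\<in>keys (pure_tensor vs).
        single (i # is) (lookup v i * lookup (pure_tensor vs) is))"

text \<open>For linear \<open>g\<close>, this is \<open>g\<close> applied in every tensor factor.\<close>

definition tensor_map :: "('a stdrep \<Rightarrow> 'a stdrep) \<Rightarrow> 'a tensor \<Rightarrow> 'a::field tensor" where
  "tensor_map g = lin_ext (\<lambda>js. pure_tensor (map (\<lambda>j. g (single j 1)) js))"

definition is_partition :: "nat list \<Rightarrow> bool" where
  "is_partition \<mu> \<longleftrightarrow> sorted_wrt (\<ge>) \<mu> \<and> (\<forall>k\<in>set \<mu>. 0 < k)"

text \<open>
  The boxes (row, column) of the Young diagram in reading order; the position of a box in this list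
  is its entry in the canonical tableau.
\<close>

definition boxes :: "nat list \<Rightarrow> (nat \<times> nat) list" where
  "boxes \<mu> = concat (map (\<lambda>i. map (\<lambda>j. (i, j)) [0..<\<mu> ! i]) [0..<length \<mu>])"

definition row_group :: "nat list \<Rightarrow> (nat \<Rightarrow> nat) set" where
  "row_group \<mu> = {p. p permutes {..<sum_list \<mu>} \<and>
     (\<forall>k<sum_list \<mu>. fst (boxes \<mu> ! p k) = fst (boxes \<mu> ! k))}"

definition col_group :: "nat list \<Rightarrow> (nat \<Rightarrow> nat) set" where
  "col_group \<mu> = {q. q permutes {..<sum_list \<mu>} \<and>
     (\<forall>k<sum_list \<mu>. snd (boxes \<mu> ! q k) = snd (boxes \<mu> ! k))}"

text \<open>
  The Young symmetrizer \<open>(\<Sum>\<^sub>p p) (\<Sum>\<^sub>q sgn(q) q)\<close>, where the symmetric group acts from the right by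
  \<open>(v\<^sub>1 \<otimes> \<dots> \<otimes> v\<^sub>d) \<sigma> = v\<^bsub>\<sigma>(1)\<^esub> \<otimes> \<dots> \<otimes> v\<^bsub>\<sigma>(d)\<^esub>\<close>.
\<close>

definition young_symmetrizer :: "nat list \<Rightarrow> 'a tensor \<Rightarrow> 'a::field tensor" where
  "young_symmetrizer \<mu> = lin_ext (\<lambda>js. \<Sum>p\<in>row_group \<mu>. \<Sum>q\<in>col_group \<mu>.
     single (permute_list (p \<circ> q) js) (of_int (sign q)))"

text \<open>The representation \<open>V\<^sub>\<mu> = S\<^sub>\<mu>(V)\<close>, as a subrepresentation of a tensor power of \<open>V\<close>.\<close>

definition schur :: "nat list \<Rightarrow> 'a::field tensor set" where
  "schur \<mu> = young_symmetrizer \<mu> ` tensor_power (sum_list \<mu>)"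


section \<open>Symmetric algebras\<close>

text \<open>
  \<open>Sym(W)\<close>, for a subspace \<open>W\<close> of a vector space \<open>'w\<close> with scalar multiplication \<open>s\<close>, is the
  polynomial ring with one variable for each vector of \<open>W\<close>, modulo the relations making
  \<open>w \<mapsto> mpoly_var w\<close> linear.
\<close>

type_synonym ('w, 'a) mpoly = "('w \<Rightarrow>\<^sub>0 nat) \<Rightarrow>\<^sub>0 'a"

definition mpoly_var :: "'w \<Rightarrow> ('w, 'a::field) mpoly" where
  "mpoly_var w = single (single w 1) 1"

definition mpoly_const :: "'a \<Rightarrow> ('w, 'a::field) mpoly" where
  "mpoly_const c = single 0 c"

definition mpoly_ring :: "'w set \<Rightarrow> ('w, 'a::field) mpoly ring" where
  "mpoly_ring W = \<lparr>carrier = {p. \<forall>m\<in>keys p. keys m \<subseteq> W},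
     monoid.mult = (*), one = 1, ring.zero = 0, add = (+)\<rparr>"

definition sym_ideal ::
  "('a \<Rightarrow> 'w \<Rightarrow> 'w) \<Rightarrow> 'w set \<Rightarrow> ('w::ab_group_add, 'a::field) mpoly set" where
  "sym_ideal s W = Idl\<^bsub>mpoly_ring W\<^esub>
     ({mpoly_var (u + v) - mpoly_var u - mpoly_var v | u v. u \<in> W \<and> v \<in> W} \<union>
      {mpoly_var (s c u) - mpoly_const c * mpoly_var u | c u. u \<in> W})"

definition sym_alg ::
  "('a \<Rightarrow> 'w \<Rightarrow> 'w) \<Rightarrow> 'w set \<Rightarrow> ('w::ab_group_add, 'a::field) mpoly set ring" where
  "sym_alg s W = mpoly_ring W Quot sym_ideal s W"

definition sym_const ::
  "('a \<Rightarrow> 'w \<Rightarrow> 'w) \<Rightarrow> 'w set \<Rightarrow> 'a \<Rightarrow> ('w::ab_group_add, 'a::field) mpoly set" where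
  "sym_const s W c = sym_ideal s W +>\<^bsub>mpoly_ring W\<^esub> mpoly_const c"

definition mpoly_subst :: "('w \<Rightarrow> 'w) \<Rightarrow> ('w, 'a) mpoly \<Rightarrow> ('w, 'a::field) mpoly" where
  "mpoly_subst f p =
     (\<Sum>m\<in>keys p. mpoly_const (lookup p m) * (\<Prod>w\<in>keys m. mpoly_var (f w) ^ lookup m w))"

text \<open>
  The endomorphism of \<open>Sym(W)\<close> induced by a linear \<open>f : W \<rightarrow> W\<close>. Substitution preserves the
  relations, so all cosets in the union coincide.
\<close>

definition sym_map ::
  "('a \<Rightarrow> 'w \<Rightarrow> 'w) \<Rightarrow> 'w set \<Rightarrow> ('w \<Rightarrow> 'w) \<Rightarrow>
     ('w, 'a) mpoly set \<Rightarrow> ('w::ab_group_add, 'a::field) mpoly set" where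
  "sym_map s W f a = (\<Union>p\<in>a. sym_ideal s W +>\<^bsub>mpoly_ring W\<^esub> mpoly_subst f p)"


section \<open>Affine schemes with group action\<close>

definition spec :: "'r ring \<Rightarrow> 'r set set" where
  "spec A = {P. primeideal P A}"

definition zariski_closed :: "'r ring \<Rightarrow> 'r set set \<Rightarrow> bool" where
  "zariski_closed A Z \<longleftrightarrow> (\<exists>S\<subseteq>carrier A. Z = {P \<in> spec A. S \<subseteq> P})"

text \<open>
  The action on \<open>Spec A\<close> of a group acting on \<open>A\<close> is \<open>g \<cdot> P = g(P)\<close>. The argument \<open>\<Gamma>\<close> is the set
  of automorphisms of \<open>A\<close> by which the group acts.
\<close>

definition stable :: "('r \<Rightarrow> 'r) set \<Rightarrow> 'r set set \<Rightarrow> bool" where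
  "stable \<Gamma> Z \<longleftrightarrow> (\<forall>\<alpha>\<in>\<Gamma>. \<forall>P\<in>Z. \<alpha> ` P \<in> Z)"

definition orbit_closure :: "'r ring \<Rightarrow> ('r \<Rightarrow> 'r) set \<Rightarrow> 'r set \<Rightarrow> 'r set set" where
  "orbit_closure A \<Gamma> x = \<Inter>{Z. zariski_closed A Z \<and> stable \<Gamma> Z \<and> x \<in> Z}"

definition generic :: "'r ring \<Rightarrow> ('r \<Rightarrow> 'r) set \<Rightarrow> 'r set \<Rightarrow> bool" where
  "generic A \<Gamma> x \<longleftrightarrow> x \<in> spec A \<and> orbit_closure A \<Gamma> x = spec A"


section \<open>The space attached to a tuple of partitions\<close>

definition pure_tuple :: "nat list list \<Rightarrow> bool" where
  "pure_tuple lam \<longleftrightarrow> [] \<notin> set lam"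

text \<open>Component \<open>i\<close> of an element of the direct sum lies in \<open>V\<close> with subscript \<open>lam ! i\<close>.\<close>

type_synonym 'a tuple_vec = "nat \<Rightarrow>\<^sub>0 'a tensor"
type_synonym 'a tuple_fun = "('a tuple_vec, 'a) mpoly set"

definition tuple_rep :: "nat list list \<Rightarrow> 'a::field tuple_vec set" where
  "tuple_rep lam = {w. \<forall>i. lookup w i \<in> (if i < length lam then schur (lam ! i) else {0})}"

definition tuple_scale :: "'a \<Rightarrow> 'a tuple_vec \<Rightarrow> 'a::field tuple_vec" where
  "tuple_scale c w = Poly_Mapping.map (vscale c) w"

definition tuple_act :: "('a stdrep \<Rightarrow> 'a stdrep) \<Rightarrow> 'a tuple_vec \<Rightarrow> 'a::field tuple_vec" where
  "tuple_act g w = Poly_Mapping.map (tensor_map g) w"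

definition coord_ring :: "nat list list \<Rightarrow> 'a::field tuple_fun ring" where
  "coord_ring lam = sym_alg tuple_scale (tuple_rep lam)"

definition GL_action :: "nat list list \<Rightarrow> ('a tuple_fun \<Rightarrow> 'a::field tuple_fun) set" where
  "GL_action lam = (\<lambda>g. sym_map tuple_scale (tuple_rep lam) (tuple_act g)) ` GL"

definition GL_generic :: "nat list list \<Rightarrow> 'a::field tuple_fun set \<Rightarrow> bool" where
  "GL_generic lam x \<longleftrightarrow> generic (coord_ring lam) (GL_action lam) x"

text \<open>
  A \<open>K\<close>-point is a \<open>K\<close>-algebra homomorphism from the coordinate ring to \<open>K\<close>; its underlying point
  of the spectrum is the kernel.
\<close>

definition K_points :: "nat list list \<Rightarrow> ('a tuple_fun \<Rightarrow> 'a::field) set" where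
  "K_points lam = {\<phi> \<in> Ring.ring_hom (coord_ring lam) ring_of_type_algebra.
     \<forall>c. \<phi> (sym_const tuple_scale (tuple_rep lam) c) = c}"

definition underlying_point :: "nat list list \<Rightarrow> ('a tuple_fun \<Rightarrow> 'a::field) \<Rightarrow> 'a tuple_fun set" where
  "underlying_point lam \<phi> = a_kernel (coord_ring lam) ring_of_type_algebra \<phi>"

end

theory Submission
  imports Defs "HOL-Library.Countable"
begin

text \<open>
  A \<open>K\<close>-point of the space is a linear functional \<open>\<phi>\<close> on \<open>W = \<Oplus>\<^sub>i V\<^bsub>\<lambda>\<^sub>i\<^esub>\<close>, and an element \<open>g\<close> of \<open>GL\<close> moves it to \<open>\<phi> \<circ> g\<close> (up to
  inverting \<open>g\<close>). Closed sets are cut out by elements of \<open>Sym(W)\<close>, so \<open>\<phi>\<close> is generic as soon as no nonzero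
  \<open>p \<in> Sym(W)\<close> vanishes at all \<open>\<phi> \<circ> g\<close> (\<open>generic_if_orbit_dense\<close>). As \<open>K\<close> is infinite, a nonzero \<open>p\<close> is at least
  nonzero at some functional (\<open>functionals_separate\<close>).

  If the empty partition occurs in the tuple, then \<open>W\<close> contains a nonzero invariant vector. It is a function on
  the space that is constant on orbits but not constant, and no point is generic
  (\<open>not_generic_if_invariant_vector\<close>).

  If the tuple is pure, a generic \<open>\<phi>\<close> can be written down. The basis of \<open>V\<close> has room for infinitely many disjoint
  blocks, and \<open>\<phi>\<close> is the sum of functionals supported on one block each, such that every coordinate functional
  \<open>b\<close> of every component occurs on infinitely many blocks. Given \<open>p\<close>, only finitely many coordinates \<open>b\<close> and basis
  vectors \<open>e\<^sub>j\<close> matter. Choose for each \<open>b\<close> a block far beyond these basis vectors, and let \<open>g\<close> send \<open>e\<^sub>j\<close> to \<open>e\<^sub>j\<close> plus the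
  sum over \<open>b\<close> of \<open>t\<^sub>b\<close> times its copy in the block of \<open>b\<close>. Mixed terms vanish as the blocks are disjoint, so on
  the vectors in question \<open>\<phi> \<circ> g = \<phi> + \<Sum>\<^sub>b t\<^sub>b^d\<^sub>b b\<close>, where \<open>d\<^sub>b\<close> is the degree of the tensor power on which \<open>b\<close> lives
  (\<open>universal_coeff_unipotent\<close>). Purity says \<open>d\<^sub>b > 0\<close>. Every functional on these vectors is a translate \<open>\<phi> + \<Sum>\<^sub>b s\<^sub>b b\<close>;
  since \<open>p\<close> is nonzero for some \<open>s\<close>, it is nonzero for some \<open>s\<^sub>b = t\<^sub>b^d\<^sub>b\<close>, changing one coordinate after the other
  (\<open>nonvanishing_at_powers\<close>, \<open>universal_orbit_dense\<close>).

  Genericity also involves that \<open>GL\<close> acts on the spectrum at all. This rests on the functoriality of tensor powers and on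
  Young symmetrizers commuting with it (\<open>tensor_map_compose\<close>, \<open>tensor_map_young_symmetrizer\<close>).
\<close>

section \<open>Evaluating polynomials\<close>

text \<open>
The coefficient map \<open>h\<close> is a parameter so that three operations are instances of one ring
homomorphism: evaluation at a point (\<open>h\<close> the identity), substitution of polynomials for variables
(\<open>h\<close> the constant polynomials), and restriction to a line or a curve (\<open>h\<close> into univariate polynomials).
\<close>

definition mpoly_eval :: "('a::field \<Rightarrow> 'r::comm_ring_1) \<Rightarrow> ('w \<Rightarrow> 'r) \<Rightarrow> ('w, 'a) mpoly \<Rightarrow> 'r" where
  "mpoly_eval h x p = (\<Sum>m\<in>keys p. h (lookup p m) * (\<Prod>w\<in>keys m. x w ^ lookup m w))"

definition mpoly_vars :: "('w, 'a::field) mpoly \<Rightarrow> 'w set" where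
  "mpoly_vars p = (\<Union>m\<in>keys p. keys m)"

lemma finite_mpoly_vars: "finite (mpoly_vars p)"
  by (simp add: mpoly_vars_def)

lemma mpoly_eval_cong:
  assumes "\<And>w. w \<in> mpoly_vars p \<Longrightarrow> x w = y w"
  shows "mpoly_eval h x p = mpoly_eval h y p"
proof -
  have "x w = y w" if "m \<in> keys p" "w \<in> keys m" for m w
    using assms that unfolding mpoly_vars_def by blast
  then show ?thesis
    unfolding mpoly_eval_def by (intro sum.cong refl arg_cong2[where f = "(*)"] prod.cong) auto
qed

lemma mpoly_subst_eq_eval: "mpoly_subst f = mpoly_eval mpoly_const (mpoly_var \<circ> f)"
  by (simp add: fun_eq_iff mpoly_subst_def mpoly_eval_def)

lemma prod_keys_superset:
  assumes "finite S" "keys m \<subseteq> S"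
  shows "(\<Prod>w\<in>keys m. x w ^ lookup m w) = (\<Prod>w\<in>S. x w ^ lookup m w :: 'r::comm_ring_1)"
  by (rule prod.mono_neutral_left) (use assms in \<open>auto simp: in_keys_iff\<close>)

lemma monomial_eval_add:
  fixes x :: "'w \<Rightarrow> 'r::comm_ring_1"
  shows "(\<Prod>w\<in>keys (m + m'). x w ^ lookup (m + m') w) =
    (\<Prod>w\<in>keys m. x w ^ lookup m w) * (\<Prod>w\<in>keys m'. x w ^ lookup m' w)"
proof -
  let ?S = "keys m \<union> keys m'"
  have "(\<Prod>w\<in>keys (m + m'). x w ^ lookup (m + m') w) = (\<Prod>w\<in>?S. x w ^ lookup (m + m') w)"
    by (rule prod_keys_superset) (use keys_add[of m m'] in auto)
  also have "\<dots> = (\<Prod>w\<in>?S. x w ^ lookup m w) * (\<Prod>w\<in>?S. x w ^ lookup m' w)"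
    by (simp add: lookup_add power_add prod.distrib)
  also have "\<dots> = (\<Prod>w\<in>keys m. x w ^ lookup m w) * (\<Prod>w\<in>keys m'. x w ^ lookup m' w)"
    by (simp add: prod_keys_superset[of ?S m x] prod_keys_superset[of ?S m' x])
  finally show ?thesis .
qed

lemma poly_mapping_sum_single: "(\<Sum>m\<in>keys p. single m (lookup p m)) = p"
proof (rule poly_mapping_eqI)
  fix k
  show "lookup (\<Sum>m\<in>keys p. single m (lookup p m)) k = lookup p k"
    by (simp add: lookup_sum lookup_single when_def in_keys_iff)
qed

locale coeff_hom =
  fixes h :: "'a::field \<Rightarrow> 'r::comm_ring_1"
  assumes h_add: "h (a + b) = h a + h b"
    and h_mult: "h (a * b) = h a * h b"
    and h_one: "h 1 = 1"
begin

lemma h_zero: "h 0 = 0"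
  using h_add[of 0 0] by simp

lemma mpoly_eval_superset:
  assumes "finite S" "keys p \<subseteq> S"
  shows "mpoly_eval h x p = (\<Sum>m\<in>S. h (lookup p m) * (\<Prod>w\<in>keys m. x w ^ lookup m w))"
  unfolding mpoly_eval_def
  by (rule sum.mono_neutral_left) (use assms in \<open>auto simp: in_keys_iff h_zero\<close>)

lemma mpoly_eval_add: "mpoly_eval h x (p + q) = mpoly_eval h x p + mpoly_eval h x q"
proof -
  let ?S = "keys p \<union> keys q"
  have "mpoly_eval h x (p + q) = (\<Sum>m\<in>?S. h (lookup (p + q) m) * (\<Prod>w\<in>keys m. x w ^ lookup m w))"
    by (rule mpoly_eval_superset) (use keys_add[of p q] in auto)
  also have "\<dots> = mpoly_eval h x p + mpoly_eval h x q"
    by (simp add: mpoly_eval_superset[of ?S] lookup_add h_add distrib_right sum.distrib)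
  finally show ?thesis .
qed

lemma mpoly_eval_zero: "mpoly_eval h x 0 = 0"
  by (simp add: mpoly_eval_def)

lemma mpoly_eval_uminus: "mpoly_eval h x (- p) = - mpoly_eval h x p"
  using mpoly_eval_add[of x p "- p"] by (simp add: mpoly_eval_zero eq_neg_iff_add_eq_0 add.commute)

lemma mpoly_eval_diff: "mpoly_eval h x (p - q) = mpoly_eval h x p - mpoly_eval h x q"
  using mpoly_eval_add[of x p "- q"] by (simp add: mpoly_eval_uminus)

lemma mpoly_eval_sum: "mpoly_eval h x (sum f A) = (\<Sum>a\<in>A. mpoly_eval h x (f a))"
  by (induction A rule: infinite_finite_induct) (auto simp: mpoly_eval_add mpoly_eval_zero)

lemma mpoly_eval_single: "mpoly_eval h x (single m c) = h c * (\<Prod>w\<in>keys m. x w ^ lookup m w)"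
  by (simp add: mpoly_eval_def h_zero)

lemma mpoly_eval_const: "mpoly_eval h x (mpoly_const c) = h c"
  by (simp add: mpoly_const_def mpoly_eval_single)

lemma mpoly_eval_var: "mpoly_eval h x (mpoly_var w) = x w"
  by (simp add: mpoly_var_def mpoly_eval_single h_one)

lemma mpoly_eval_one: "mpoly_eval h x 1 = 1"
  using mpoly_eval_const[of x 1] by (simp add: mpoly_const_def h_one)

lemma mpoly_eval_mult: "mpoly_eval h x (p * q) = mpoly_eval h x p * mpoly_eval h x q"
proof -
  have "p * q = (\<Sum>m\<in>keys p. \<Sum>n\<in>keys q. single m (lookup p m) * single n (lookup q n))"
    by (simp flip: sum_product add: poly_mapping_sum_single)
  then have "mpoly_eval h x (p * q) = (\<Sum>m\<in>keys p. \<Sum>n\<in>keys q.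
      (h (lookup p m) * (\<Prod>w\<in>keys m. x w ^ lookup m w)) *
      (h (lookup q n) * (\<Prod>w\<in>keys n. x w ^ lookup n w)))"
    by (simp add: mpoly_eval_sum mult_single mpoly_eval_single monomial_eval_add h_mult mult_ac)
  then show ?thesis
    by (simp add: mpoly_eval_def sum_product)
qed

lemma mpoly_eval_power: "mpoly_eval h x (p ^ n) = mpoly_eval h x p ^ n"
  by (induction n) (auto simp: mpoly_eval_mult mpoly_eval_one)

lemma mpoly_eval_prod: "mpoly_eval h x (prod f A) = (\<Prod>a\<in>A. mpoly_eval h x (f a))"
  by (induction A rule: infinite_finite_induct) (auto simp: mpoly_eval_mult mpoly_eval_one)

lemma mpoly_eval_eval:
  "mpoly_eval h x (mpoly_eval mpoly_const y p) = mpoly_eval h (\<lambda>w. mpoly_eval h x (y w)) p"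
  unfolding mpoly_eval_def[of mpoly_const y p] mpoly_eval_def[of h "\<lambda>w. mpoly_eval h x (y w)" p]
  by (simp add: mpoly_eval_sum mpoly_eval_mult mpoly_eval_prod mpoly_eval_power mpoly_eval_const)

lemma mpoly_eval_subst: "mpoly_eval h x (mpoly_subst f p) = mpoly_eval h (x \<circ> f) p"
  by (simp add: mpoly_subst_eq_eval mpoly_eval_eval mpoly_eval_var o_def)

end

interpretation coeff_id: coeff_hom "\<lambda>a::'a::field. a"
  by unfold_locales simp_all

interpretation coeff_mpoly: coeff_hom "mpoly_const :: 'a::field \<Rightarrow> ('w, 'a) mpoly"
  by unfold_locales (simp_all add: mpoly_const_def single_add mult_single)

interpretation coeff_poly: coeff_hom "\<lambda>a::'a::field. [:a:]"
  by unfold_locales (simp_all add: one_pCons)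

lemma poly_mpoly_eval:
  "poly (mpoly_eval (\<lambda>a. [:a:]) x p) z = mpoly_eval (\<lambda>a. a) (\<lambda>w. poly (x w) z) p"
  by (simp add: mpoly_eval_def poly_sum poly_prod)

lemma mpoly_var_power: "mpoly_var w ^ n = single (single w n) 1"
  by (induction n) (auto simp: mpoly_var_def mult_single simp flip: single_add)

lemma mpoly_eval_id: "mpoly_eval mpoly_const mpoly_var p = p"
proof -
  have *: "(\<Prod>w\<in>A. mpoly_var w ^ lookup m w) = single (\<Sum>w\<in>A. single w (lookup m w)) 1" for A m
    by (induction A rule: infinite_finite_induct) (auto simp: mpoly_var_power mult_single)
  show ?thesis
    unfolding mpoly_eval_def *
    by (simp add: mpoly_const_def mult_single poly_mapping_sum_single)
qed

lemma mpoly_subst_compose: "mpoly_subst f (mpoly_subst g p) = mpoly_subst (f \<circ> g) p"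
  using coeff_mpoly.mpoly_eval_subst[of "mpoly_var \<circ> f" g p]
  by (simp add: mpoly_subst_eq_eval o_assoc)

lemma mpoly_subst_cong_id:
  assumes "\<And>w. w \<in> mpoly_vars p \<Longrightarrow> f w = w"
  shows "mpoly_subst f p = p"
  unfolding mpoly_subst_eq_eval
  using mpoly_eval_cong[of p "mpoly_var \<circ> f" mpoly_var mpoly_const] assms by (simp add: mpoly_eval_id)

section \<open>Points where a polynomial does not vanish\<close>

text \<open>
Kronecker's trick: the weights are the place values of a positional number system whose digits are the exponents.
In the induction the new variable takes weight \<open>1\<close>, and all earlier weights are multiplied by a base \<open>D\<close> larger
than its exponents.
\<close>

lemma separating_weights:
  assumes "finite V" "finite M" "\<And>m. m \<in> M \<Longrightarrow> keys m \<subseteq> V"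
  shows "\<exists>e::'w \<Rightarrow> nat. inj_on (\<lambda>m::'w \<Rightarrow>\<^sub>0 nat. \<Sum>w\<in>V. lookup m w * e w) M"
  using assms
proof (induction V arbitrary: M rule: finite_induct)
  case empty
  then show ?case
    by (intro exI inj_onI, simp) (metis keys_eq_empty)
next
  case (insert v V)
  define rest where "rest m = m - single v (lookup m v)" for m :: "'w \<Rightarrow>\<^sub>0 nat"
  have lookup_rest: "lookup (rest m) w = (if w = v then 0 else lookup m w)" for m w
    by (simp add: rest_def lookup_minus lookup_single when_def)
  have "keys (rest m) \<subseteq> V" if "m \<in> M" for m
  proof
    fix w assume "w \<in> keys (rest m)"
    then have "w \<noteq> v" "w \<in> keys m" by (simp_all add: in_keys_iff lookup_rest split: if_splits)
    then show "w \<in> V" using insert.prems(2)[OF that] by blast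
  qed
  then obtain e where e: "inj_on (\<lambda>m. \<Sum>w\<in>V. lookup m w * e w) (rest ` M)"
    using insert.IH[of "rest ` M"] insert.prems(1) by blast
  obtain D where D: "\<And>m. m \<in> M \<Longrightarrow> lookup m v < D"
    using insert.prems(1) finite_nat_set_iff_bounded[of "(\<lambda>m. lookup m v) ` M"] by auto
  define e' where "e' w = (if w = v then 1 else D * e w)" for w
  have split: "(\<Sum>w\<in>insert v V. lookup m w * e' w) =
      lookup m v + D * (\<Sum>w\<in>V. lookup (rest m) w * e w)" for m
    using insert.hyps by (auto simp: e'_def lookup_rest sum_distrib_left mult_ac intro!: sum.cong)
  show ?case
  proof (intro exI[of _ e'] inj_onI)
    fix m m' assume m: "m \<in> M" "m' \<in> M"
      and eq: "(\<Sum>w\<in>insert v V. lookup m w * e' w) = (\<Sum>w\<in>insert v V. lookup m' w * e' w)"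
    from arg_cong[OF eq[unfolded split], of "\<lambda>k. k mod D"] D m
    have v: "lookup m v = lookup m' v" by simp
    moreover have "D > 0" using D[OF m(1)] by simp
    ultimately have "(\<Sum>w\<in>V. lookup (rest m) w * e w) = (\<Sum>w\<in>V. lookup (rest m') w * e w)"
      using eq[unfolded split] by simp
    then have "rest m = rest m'"
      using e m by (auto dest: inj_onD)
    then show "m = m'"
      by (intro poly_mapping_eqI) (metis lookup_rest v)
  qed
qed

text \<open>
Substituting \<open>z ^ e w\<close> for each variable \<open>w\<close>, with separating weights \<open>e\<close>, sends distinct monomials of
\<open>p\<close> to distinct powers of \<open>z\<close>; the result is a nonzero univariate polynomial, and it has a non-root
because the field is infinite.
\<close>

lemma mpoly_nonvanishing_point:
  fixes p :: "('w, 'a::field_char_0) mpoly"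
  assumes "p \<noteq> 0"
  shows "\<exists>x. mpoly_eval (\<lambda>a. a) x p \<noteq> 0"
proof -
  let ?V = "mpoly_vars p"
  obtain e where e: "inj_on (\<lambda>m. \<Sum>w\<in>?V. lookup m w * e w) (keys p)"
    using separating_weights[of ?V "keys p"] finite_mpoly_vars[of p] by (force simp: mpoly_vars_def)
  define E where "E m = (\<Sum>w\<in>?V. lookup m w * e w)" for m
  let ?x = "\<lambda>w. monom 1 (e w) :: 'a poly"
  have mono: "(\<Prod>w\<in>keys m. ?x w ^ lookup m w) = monom 1 (E m)" if "m \<in> keys p" for m
  proof -
    have "(\<Prod>w\<in>keys m. ?x w ^ lookup m w) = (\<Prod>w\<in>?V. ?x w ^ lookup m w)"
      by (rule prod_keys_superset) (use that finite_mpoly_vars[of p] in \<open>auto simp: mpoly_vars_def\<close>)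
    also have "\<dots> = (\<Prod>w\<in>?V. monom 1 (lookup m w * e w))"
      by (simp add: monom_power mult.commute)
    also have "\<dots> = monom 1 (E m)"
    proof -
      have "(\<Prod>w\<in>V. monom 1 (f w)) = (monom 1 (\<Sum>w\<in>V. f w) :: 'a poly)" for V :: "'w set" and f
        by (induction V rule: infinite_finite_induct) (auto simp: mult_monom)
      then show ?thesis unfolding E_def .
    qed
    finally show ?thesis .
  qed
  have eq: "mpoly_eval (\<lambda>a. [:a:]) ?x p = (\<Sum>m\<in>keys p. monom (lookup p m) (E m))"
    unfolding mpoly_eval_def by (intro sum.cong refl) (simp add: mono smult_monom)
  obtain m where m: "m \<in> keys p" using assms by (metis keys_eq_empty ex_in_conv)
  have "coeff (mpoly_eval (\<lambda>a. [:a:]) ?x p) (E m) = (\<Sum>n\<in>keys p. if n = m then lookup p n else 0)"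
    unfolding eq coeff_sum
    by (intro sum.cong refl) (use e m in \<open>auto simp: E_def[symmetric] dest: inj_onD\<close>)
  also have "\<dots> \<noteq> 0" using m by (simp add: in_keys_iff)
  finally have "mpoly_eval (\<lambda>a. [:a:]) ?x p \<noteq> 0" by auto
  then obtain z where "poly (mpoly_eval (\<lambda>a. [:a:]) ?x p) z \<noteq> 0"
    using poly_all_0_iff_0 by blast
  then show ?thesis unfolding poly_mpoly_eval by blast
qed

lemma nonzero_at_power:
  fixes Q :: "'a::field_char_0 poly"
  assumes "Q \<noteq> 0" "d > 0"
  shows "\<exists>z. poly Q (z ^ d) \<noteq> 0"
proof -
  have "pcompose Q (monom 1 d) \<noteq> 0"
    using assms pcompose_eq_0[of Q "monom 1 d"] by (auto simp: degree_monom_eq)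
  then obtain z where "poly (pcompose Q (monom 1 d)) z \<noteq> 0"
    using poly_all_0_iff_0 by blast
  then show ?thesis by (auto simp: poly_pcompose poly_monom)
qed

text \<open>
The values of \<open>s\<close> are replaced one coordinate at a time: as a function of a single coordinate \<open>F\<close> is a
univariate polynomial, and a polynomial that is nonzero somewhere is nonzero at some \<open>d\<close>-th power. This is
how orbits, on which the coordinates only take the form \<open>t ^ d\<close>, are seen to be dense although \<open>K\<close> need not
contain \<open>d\<close>-th roots.
\<close>

lemma nonvanishing_at_powers:
  fixes F :: "('b \<Rightarrow> 'a::field_char_0) \<Rightarrow> 'a"
  assumes "finite A" and poly: "\<And>s b. \<exists>Q. \<forall>z. F (s(b := z)) = poly Q z"
    and d: "\<And>b. b \<in> A \<Longrightarrow> d b > 0" and nz: "F s \<noteq> 0"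
  shows "\<exists>t. F (\<lambda>b. if b \<in> A then t b ^ d b else s b) \<noteq> 0"
  using assms(1) d
proof (induction A rule: finite_induct)
  case empty
  then show ?case using nz by simp
next
  case (insert a A)
  then obtain t where t: "F (\<lambda>b. if b \<in> A then t b ^ d b else s b) \<noteq> 0" by auto
  define r where "r b = (if b \<in> A then t b ^ d b else s b)" for b
  obtain Q where Q: "\<And>z. F (r(a := z)) = poly Q z" using poly by blast
  have "F r \<noteq> 0" using t by (simp add: r_def[abs_def])
  then have "poly Q (r a) \<noteq> 0" using Q[of "r a"] by simp
  then have "Q \<noteq> 0" by auto
  then obtain z where z: "poly Q (z ^ d a) \<noteq> 0" using nonzero_at_power insert.prems by blast
  have "(\<lambda>b. if b \<in> insert a A then (t(a := z)) b ^ d b else s b) = r(a := z ^ d a)"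
    using insert.hyps by (auto simp: r_def)
  then show ?case using z Q by metis
qed

section \<open>The polynomial ring on a set of variables\<close>

lemma mpoly_ring_simps [simp]:
  "x \<in> carrier (mpoly_ring W) \<longleftrightarrow> mpoly_vars x \<subseteq> W"
  "x \<otimes>\<^bsub>mpoly_ring W\<^esub> y = x * y" "x \<oplus>\<^bsub>mpoly_ring W\<^esub> y = x + y"
  "\<one>\<^bsub>mpoly_ring W\<^esub> = 1" "\<zero>\<^bsub>mpoly_ring W\<^esub> = 0"
  by (auto simp: mpoly_ring_def mpoly_vars_def)

lemma mpoly_vars_zero [simp]: "mpoly_vars 0 = {}"
  by (simp add: mpoly_vars_def)

lemma mpoly_vars_const [simp]: "mpoly_vars (mpoly_const c) = {}"
  by (simp add: mpoly_vars_def mpoly_const_def)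

lemma mpoly_vars_one [simp]: "mpoly_vars 1 = {}"
  by (simp add: mpoly_vars_def)

lemma mpoly_vars_var [simp]: "mpoly_vars (mpoly_var w) = {w}"
  by (simp add: mpoly_vars_def mpoly_var_def)

lemma mpoly_vars_uminus [simp]: "mpoly_vars (- p) = mpoly_vars p"
  by (simp add: mpoly_vars_def)

lemma mpoly_vars_add: "mpoly_vars (p + q) \<subseteq> mpoly_vars p \<union> mpoly_vars q"
  using keys_add[of p q] by (auto simp: mpoly_vars_def)

lemma mpoly_vars_diff: "mpoly_vars (p - q) \<subseteq> mpoly_vars p \<union> mpoly_vars q"
  using mpoly_vars_add[of p "- q"] by simp

lemma mpoly_vars_mult: "mpoly_vars (p * q) \<subseteq> mpoly_vars p \<union> mpoly_vars q"
proof
  fix w assume "w \<in> mpoly_vars (p * q)"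
  then obtain m where "m \<in> keys (p * q)" "w \<in> keys m" by (auto simp: mpoly_vars_def)
  moreover from this obtain a b where "m = a + b" "a \<in> keys p" "b \<in> keys q"
    using keys_mult[of p q] by auto
  ultimately show "w \<in> mpoly_vars p \<union> mpoly_vars q"
    using keys_add[of a b] by (auto simp: mpoly_vars_def)
qed

lemma mpoly_vars_power: "mpoly_vars (p ^ n) \<subseteq> mpoly_vars p"
proof (induction n)
  case (Suc n)
  then show ?case using mpoly_vars_mult[of p "p ^ n"] by auto
qed simp

lemma mpoly_vars_closed [simp]:
  assumes "mpoly_vars p \<subseteq> W" "mpoly_vars q \<subseteq> W"
  shows "mpoly_vars (p + q) \<subseteq> W" "mpoly_vars (p - q) \<subseteq> W" "mpoly_vars (p * q) \<subseteq> W"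
  using mpoly_vars_add[of p q] mpoly_vars_diff[of p q] mpoly_vars_mult[of p q] assms by auto

lemma mpoly_vars_sum:
  assumes "\<And>a. a \<in> A \<Longrightarrow> mpoly_vars (f a) \<subseteq> W"
  shows "mpoly_vars (sum f A) \<subseteq> W"
  using assms
proof (induction A rule: infinite_finite_induct)
  case (insert a A)
  then show ?case using mpoly_vars_add[of "f a" "sum f A"] by auto
qed auto

lemma mpoly_vars_prod:
  assumes "\<And>a. a \<in> A \<Longrightarrow> mpoly_vars (f a) \<subseteq> W"
  shows "mpoly_vars (prod f A) \<subseteq> W"
  using assms
proof (induction A rule: infinite_finite_induct)
  case (insert a A)
  then show ?case using mpoly_vars_mult[of "f a" "prod f A"] by auto
qed auto

lemma mpoly_vars_eval:
  assumes "\<And>w. w \<in> mpoly_vars p \<Longrightarrow> mpoly_vars (x w) \<subseteq> W"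
  shows "mpoly_vars (mpoly_eval mpoly_const x p) \<subseteq> W"
proof -
  have "mpoly_vars (mpoly_const (lookup p m) * (\<Prod>w\<in>keys m. x w ^ lookup m w)) \<subseteq> W" if "m \<in> keys p" for m
  proof -
    have "mpoly_vars (\<Prod>w\<in>keys m. x w ^ lookup m w) \<subseteq> W"
    proof (rule mpoly_vars_prod)
      fix w assume "w \<in> keys m"
      then have "w \<in> mpoly_vars p" using that by (auto simp: mpoly_vars_def)
      then show "mpoly_vars (x w ^ lookup m w) \<subseteq> W" using assms[of w] mpoly_vars_power[of "x w" "lookup m w"] by blast
    qed
    then show ?thesis by (intro order_trans[OF mpoly_vars_mult]) simp
  qed
  then show ?thesis unfolding mpoly_eval_def by (rule mpoly_vars_sum)
qed

lemma mpoly_vars_subst: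
  assumes "mpoly_vars p \<subseteq> W" "f ` W \<subseteq> W'"
  shows "mpoly_vars (mpoly_subst f p) \<subseteq> W'"
  unfolding mpoly_subst_eq_eval by (rule mpoly_vars_eval) (use assms in auto)

lemma cring_mpoly_ring: "cring (mpoly_ring W :: ('w, 'a::field) mpoly ring)"
proof (rule cringI)
  show "abelian_group (mpoly_ring W :: ('w, 'a) mpoly ring)"
  proof (rule abelian_groupI)
    fix x :: "('w, 'a) mpoly" assume "x \<in> carrier (mpoly_ring W)"
    then show "\<exists>y\<in>carrier (mpoly_ring W). y \<oplus>\<^bsub>mpoly_ring W\<^esub> x = \<zero>\<^bsub>mpoly_ring W\<^esub>"
      by (intro bexI[of _ "- x"]) auto
  qed (simp_all add: add_ac)
  show "comm_monoid (mpoly_ring W :: ('w, 'a) mpoly ring)"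
    by (rule comm_monoidI) (simp_all add: mult_ac)
qed (simp add: distrib_right)

lemma a_minus_mpoly_ring [simp]:
  assumes "mpoly_vars x \<subseteq> W" "mpoly_vars y \<subseteq> W"
  shows "x \<ominus>\<^bsub>mpoly_ring W\<^esub> y = x - y"
proof -
  interpret cring "mpoly_ring W :: ('a, 'b) mpoly ring" by (rule cring_mpoly_ring)
  have "\<ominus>\<^bsub>mpoly_ring W\<^esub> y = - y"
    by (rule minus_equality) (use assms in auto)
  then show ?thesis by (simp add: a_minus_def)
qed

section \<open>Symmetric algebras\<close>

locale sym_algebra = vector_space scale
  for scale :: "'a::field_char_0 \<Rightarrow> 'w::ab_group_add \<Rightarrow> 'w" +
  fixes W :: "'w set"
  assumes subspace_W: "subspace W"
begin

abbreviation "R \<equiv> mpoly_ring W :: ('w, 'a) mpoly ring"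
abbreviation "I \<equiv> sym_ideal scale W :: ('w, 'a) mpoly set"
abbreviation "A \<equiv> sym_alg scale W :: ('w, 'a) mpoly set ring"
abbreviation "cls p \<equiv> I +>\<^bsub>R\<^esub> p"
abbreviation "ev \<equiv> mpoly_eval (\<lambda>a::'a. a)"

sublocale R: cring R by (rule cring_mpoly_ring)

abbreviation relations :: "('w, 'a) mpoly set" where
  "relations \<equiv> {mpoly_var (u + v) - mpoly_var u - mpoly_var v | u v. u \<in> W \<and> v \<in> W} \<union>
      {mpoly_var (scale c u) - mpoly_const c * mpoly_var u | c u. u \<in> W}"

lemma relations_carrier: "relations \<subseteq> carrier R"
proof -
  have "mpoly_vars (mpoly_var (u + v) - mpoly_var u - mpoly_var v :: ('w, 'a) mpoly) \<subseteq> W"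
    if "u \<in> W" "v \<in> W" for u v
    using that subspace_add[OF subspace_W] by simp
  moreover have "mpoly_vars (mpoly_var (scale c u) - mpoly_const c * mpoly_var u) \<subseteq> W"
    if "u \<in> W" for u c
    using that subspace_scale[OF subspace_W] by simp
  ultimately show ?thesis by auto
qed

lemma relations_vars: "r \<in> relations \<Longrightarrow> mpoly_vars r \<subseteq> W"
  using subsetD[OF relations_carrier, of r] by simp

sublocale I: ideal I R
  unfolding sym_ideal_def by (rule R.genideal_ideal[OF relations_carrier])

sublocale A: cring A
  unfolding sym_alg_def by (rule I.quotient_is_cring[OF R.is_cring])

lemma relations_in_I: "relations \<subseteq> I"
  unfolding sym_ideal_def by (rule R.genideal_self[OF relations_carrier])

lemma I_minimal: "ideal J R \<Longrightarrow> relations \<subseteq> J \<Longrightarrow> I \<subseteq> J"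
  unfolding sym_ideal_def by (rule R.genideal_minimal)

lemma I_vars: "p \<in> I \<Longrightarrow> mpoly_vars p \<subseteq> W"
  using subsetD[OF I.a_subset, of p] by simp

lemma I_zero: "0 \<in> I"
  using I.zero_closed by simp

lemma I_add: "p \<in> I \<Longrightarrow> q \<in> I \<Longrightarrow> p + q \<in> I"
  using I.a_closed by simp

lemma I_mult: "p \<in> I \<Longrightarrow> mpoly_vars q \<subseteq> W \<Longrightarrow> q * p \<in> I"
  using I.I_l_closed by simp

lemma cls_eq_iff:
  assumes "mpoly_vars p \<subseteq> W" "mpoly_vars q \<subseteq> W"
  shows "cls p = cls q \<longleftrightarrow> p - q \<in> I"
  using R.quotient_eq_iff_same_a_r_cos[OF I.is_ideal, of p q] assms by simp

lemma in_cls_iff: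
  assumes "mpoly_vars p \<subseteq> W"
  shows "q \<in> cls p \<longleftrightarrow> q - p \<in> I"
proof -
  have "q \<in> cls p \<longleftrightarrow> (\<exists>i\<in>I. q = i + p)" by (simp add: a_r_coset_def')
  also have "\<dots> \<longleftrightarrow> q - p \<in> I" by (metis add_diff_cancel diff_add_cancel)
  finally show ?thesis .
qed

lemma carrier_A: "carrier A = cls ` {p. mpoly_vars p \<subseteq> W}"
  by (auto simp: sym_alg_def FactRing_def A_RCOSETS_def')

lemma cls_hom: "cls \<in> Ring.ring_hom R A"
  unfolding sym_alg_def by (rule I.rcos_ring_hom)

lemma cls_mult:
  assumes "mpoly_vars p \<subseteq> W" "mpoly_vars q \<subseteq> W"
  shows "cls p \<otimes>\<^bsub>A\<^esub> cls q = cls (p * q)"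
  using ring_hom_mult[OF cls_hom, of p q] assms by simp

lemma cls_add:
  assumes "mpoly_vars p \<subseteq> W" "mpoly_vars q \<subseteq> W"
  shows "cls p \<oplus>\<^bsub>A\<^esub> cls q = cls (p + q)"
  using ring_hom_add[OF cls_hom, of p q] assms by simp

lemma one_A: "\<one>\<^bsub>A\<^esub> = cls 1"
  using ring_hom_one[OF cls_hom] by simp

lemma zero_A: "\<zero>\<^bsub>A\<^esub> = cls 0"
proof -
  have "cls 0 = I"
    using in_cls_iff[of 0] by auto
  then show ?thesis by (simp add: sym_alg_def FactRing_def)
qed

lemma I_induct [consumes 1, case_names relation add mult]:
  assumes "p \<in> I"
    and rel: "\<And>r. r \<in> relations \<Longrightarrow> P r"
    and add: "\<And>p q. mpoly_vars p \<subseteq> W \<Longrightarrow> mpoly_vars q \<subseteq> W \<Longrightarrow> P p \<Longrightarrow> P q \<Longrightarrow> P (p + q)"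
    and mult: "\<And>p q. mpoly_vars p \<subseteq> W \<Longrightarrow> mpoly_vars q \<subseteq> W \<Longrightarrow> P p \<Longrightarrow> P (q * p)"
  shows "P p"
proof -
  let ?J = "{p. mpoly_vars p \<subseteq> W \<and> P p}"
  have rel': "relations \<subseteq> ?J"
    using rel relations_vars by blast
  obtain r where r: "r \<in> relations"
    using subspace_0[OF subspace_W] by blast
  have zero: "0 \<in> ?J"
    using mult[of r 0] rel[OF r] relations_vars[OF r] by simp
  have "ideal ?J R"
  proof (rule R.ring_axioms[THEN idealI])
    show "subgroup ?J (add_monoid R)"
    proof (rule R.add.subgroupI)
      fix p assume p: "p \<in> ?J"
      then have "- p \<in> ?J" using mult[of p "- 1"] by simp
      moreover have "\<ominus>\<^bsub>R\<^esub> p = - p"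
        by (rule R.minus_equality) (use p in auto)
      ultimately show "\<ominus>\<^bsub>R\<^esub> p \<in> ?J" by simp
    next
      fix p q assume "p \<in> ?J" "q \<in> ?J"
      then show "p \<oplus>\<^bsub>R\<^esub> q \<in> ?J"
        using add[of p q] by simp
    qed (use zero in \<open>auto intro: exI[of _ 0]\<close>)
    fix p q assume pq: "p \<in> ?J" "q \<in> carrier R"
    then have "q * p \<in> ?J"
      using mult[of p q] by simp
    then show "q \<otimes>\<^bsub>R\<^esub> p \<in> ?J" "p \<otimes>\<^bsub>R\<^esub> q \<in> ?J"
      by (simp_all add: mult.commute)
  qed
  then show ?thesis using I_minimal[OF _ rel'] assms(1) by blast
qed

abbreviation functional :: "('w \<Rightarrow> 'a) \<Rightarrow> bool" where
  "functional \<equiv> Vector_Spaces.linear scale (*)"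

abbreviation endo :: "('w \<Rightarrow> 'w) \<Rightarrow> bool" where
  "endo f \<equiv> Vector_Spaces.linear scale scale f \<and> f ` W \<subseteq> W"

lemma functional_add: "functional \<psi> \<Longrightarrow> \<psi> (u + v) = \<psi> u + \<psi> v"
  by (simp add: Vector_Spaces.linear_iff)

lemma functional_scale: "functional \<psi> \<Longrightarrow> \<psi> (scale c u) = c * \<psi> u"
  by (simp add: Vector_Spaces.linear_iff)

lemma endo_add: "endo f \<Longrightarrow> f (u + v) = f u + f v"
  by (simp add: Vector_Spaces.linear_iff)

lemma endo_scale: "endo f \<Longrightarrow> f (scale c u) = scale c (f u)"
  by (simp add: Vector_Spaces.linear_iff)

lemma ev_I:
  assumes "functional \<psi>" "p \<in> I"
  shows "ev \<psi> p = 0"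
  using assms(2)
proof (induction rule: I_induct)
  case (relation r)
  then show ?case
    by (auto simp: coeff_id.mpoly_eval_diff coeff_id.mpoly_eval_var coeff_id.mpoly_eval_mult
        coeff_id.mpoly_eval_const functional_add[OF assms(1)] functional_scale[OF assms(1)])
qed (simp_all add: coeff_id.mpoly_eval_add coeff_id.mpoly_eval_mult)

lemma subst_vars: "endo f \<Longrightarrow> mpoly_vars p \<subseteq> W \<Longrightarrow> mpoly_vars (mpoly_subst f p) \<subseteq> W"
  by (rule mpoly_vars_subst) auto

lemma subst_I:
  assumes f: "endo f" and "p \<in> I"
  shows "mpoly_subst f p \<in> I"
  using assms(2)
proof (induction rule: I_induct)
  case (relation r)
  have W: "f u \<in> W" if "u \<in> W" for u using f that by blast
  from relation have "mpoly_subst f r \<in> relations"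
  proof (elim UnE CollectE exE conjE)
    fix u v assume r: "r = mpoly_var (u + v) - mpoly_var u - mpoly_var v" and uv: "u \<in> W" "v \<in> W"
    have "mpoly_subst f r = mpoly_var (f u + f v) - mpoly_var (f u) - mpoly_var (f v)"
      by (simp add: r mpoly_subst_eq_eval coeff_mpoly.mpoly_eval_diff coeff_mpoly.mpoly_eval_var endo_add[OF f])
    then show ?thesis using W uv by blast
  next
    fix u c assume r: "r = mpoly_var (scale c u) - mpoly_const c * mpoly_var u" and u: "u \<in> W"
    have "mpoly_subst f r = mpoly_var (scale c (f u)) - mpoly_const c * mpoly_var (f u)"
      by (simp add: r mpoly_subst_eq_eval coeff_mpoly.mpoly_eval_diff coeff_mpoly.mpoly_eval_mult
          coeff_mpoly.mpoly_eval_const coeff_mpoly.mpoly_eval_var endo_scale[OF f])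
    then show ?thesis using W u by blast
  qed
  then show ?case using relations_in_I by blast
next
  case (add p q)
  then show ?case by (simp add: mpoly_subst_eq_eval coeff_mpoly.mpoly_eval_add I_add)
next
  case (mult p q)
  then show ?case
    using I_mult subst_vars[OF f mult(2)] by (simp add: mpoly_subst_eq_eval coeff_mpoly.mpoly_eval_mult)
qed

section \<open>K-points of a symmetric algebra\<close>

text \<open>
The \<open>K\<close>-point of \<open>Spec Sym(W)\<close> given by a linear functional: evaluate any representative. The choice of
representative does not matter because a linear functional satisfies the defining relations.
\<close>

definition point :: "('w \<Rightarrow> 'a) \<Rightarrow> ('w, 'a) mpoly set \<Rightarrow> 'a" where
  "point \<psi> a = ev \<psi> (SOME p. p \<in> a)"

lemma point_cls:
  assumes "functional \<psi>" "mpoly_vars p \<subseteq> W"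
  shows "point \<psi> (cls p) = ev \<psi> p"
proof -
  have "p \<in> cls p" using in_cls_iff[OF assms(2)] I_zero by simp
  then have "(SOME q. q \<in> cls p) \<in> cls p" by (rule someI)
  then have "ev \<psi> ((SOME q. q \<in> cls p) - p) = 0"
    using in_cls_iff[OF assms(2)] ev_I[OF assms(1)] by blast
  then show ?thesis by (simp add: point_def coeff_id.mpoly_eval_diff)
qed

lemma point_hom:
  assumes "functional \<psi>"
  shows "point \<psi> \<in> Ring.ring_hom A ring_of_type_algebra"
proof (rule ring_hom_memI)
  fix a b assume "a \<in> carrier A" "b \<in> carrier A"
  then obtain p q where pq: "a = cls p" "b = cls q" "mpoly_vars p \<subseteq> W" "mpoly_vars q \<subseteq> W"
    by (auto simp: carrier_A)
  have "mpoly_vars (p * q) \<subseteq> W" "mpoly_vars (p + q) \<subseteq> W"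
    using pq by simp_all
  then show "point \<psi> (a \<otimes>\<^bsub>A\<^esub> b) = point \<psi> a \<otimes>\<^bsub>ring_of_type_algebra\<^esub> point \<psi> b"
    "point \<psi> (a \<oplus>\<^bsub>A\<^esub> b) = point \<psi> a \<oplus>\<^bsub>ring_of_type_algebra\<^esub> point \<psi> b"
    using pq by (simp_all add: cls_mult cls_add point_cls[OF assms] ring_of_type_algebra_def
        coeff_id.mpoly_eval_mult coeff_id.mpoly_eval_add)
qed (simp_all add: one_A point_cls[OF assms] coeff_id.mpoly_eval_one ring_of_type_algebra_def)

lemma point_const: "functional \<psi> \<Longrightarrow> point \<psi> (sym_const scale W c) = c"
  by (simp add: sym_const_def point_cls coeff_id.mpoly_eval_const)

lemma K_point_kernel_prime:
  assumes "\<phi> \<in> Ring.ring_hom A (ring_of_type_algebra :: 'a ring)"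
  shows "a_kernel A ring_of_type_algebra \<phi> \<in> spec A"
proof -
  interpret K: Ring.field "ring_of_type_algebra :: 'a ring" by (rule field_from_type_algebra)
  interpret ring_hom_ring A "ring_of_type_algebra :: 'a ring" \<phi>
    by (intro ring_hom_ringI2 A.ring_axioms K.ring_axioms assms)
  show ?thesis
    unfolding spec_def a_kernel_def' using primeideal_vimage[OF A.is_cring K.zeroprimeideal] by simp
qed

lemma in_kernel_iff: "a \<in> a_kernel A (ring_of_type_algebra :: 'a ring) \<phi> \<longleftrightarrow> a \<in> carrier A \<and> \<phi> a = 0"
  by (simp add: a_kernel_def' ring_of_type_algebra_def)

section \<open>Automorphisms induced by linear maps\<close>

lemma sym_map_cls:
  assumes f: "endo f" and p: "mpoly_vars p \<subseteq> W"
  shows "sym_map scale W f (cls p) = cls (mpoly_subst f p)"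
proof -
  have "cls (mpoly_subst f q) = cls (mpoly_subst f p)" if "q \<in> cls p" for q
  proof -
    have qp: "q - p \<in> I" using that in_cls_iff[OF p] by simp
    then have "mpoly_vars q \<subseteq> W"
      using mpoly_vars_add[of "q - p" p] I_vars p by fastforce
    then have "mpoly_vars (mpoly_subst f q) \<subseteq> W"
      by (rule subst_vars[OF f])
    moreover have "mpoly_subst f q - mpoly_subst f p \<in> I"
      using subst_I[OF f qp] by (simp add: mpoly_subst_eq_eval coeff_mpoly.mpoly_eval_diff)
    ultimately show ?thesis using subst_vars[OF f p] by (simp add: cls_eq_iff)
  qed
  moreover have "p \<in> cls p" using in_cls_iff[OF p] I_zero by simp
  ultimately show ?thesis unfolding sym_map_def by blast
qed

lemma sym_map_hom:
  assumes f: "endo f"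
  shows "sym_map scale W f \<in> Ring.ring_hom A A"
proof (rule ring_hom_memI)
  fix a assume "a \<in> carrier A"
  then obtain p where "a = cls p" "mpoly_vars p \<subseteq> W"
    by (auto simp: carrier_A)
  then show "sym_map scale W f a \<in> carrier A"
    using subst_vars[OF f, of p] by (simp add: sym_map_cls[OF f] carrier_A)
next
  fix a b assume "a \<in> carrier A" "b \<in> carrier A"
  then obtain p q where pq: "a = cls p" "b = cls q" "mpoly_vars p \<subseteq> W" "mpoly_vars q \<subseteq> W"
    by (auto simp: carrier_A)
  have "mpoly_vars (p * q) \<subseteq> W" "mpoly_vars (p + q) \<subseteq> W"
    using pq by simp_all
  moreover note subst_vars[OF f pq(3)] subst_vars[OF f pq(4)]
  ultimately show "sym_map scale W f (a \<otimes>\<^bsub>A\<^esub> b) = sym_map scale W f a \<otimes>\<^bsub>A\<^esub> sym_map scale W f b"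
    "sym_map scale W f (a \<oplus>\<^bsub>A\<^esub> b) = sym_map scale W f a \<oplus>\<^bsub>A\<^esub> sym_map scale W f b"
    using pq by (simp_all add: cls_mult cls_add sym_map_cls[OF f] mpoly_subst_eq_eval
        coeff_mpoly.mpoly_eval_mult coeff_mpoly.mpoly_eval_add)
next
  show "sym_map scale W f \<one>\<^bsub>A\<^esub> = \<one>\<^bsub>A\<^esub>"
    by (simp add: one_A sym_map_cls[OF f] mpoly_subst_eq_eval coeff_mpoly.mpoly_eval_one)
qed

lemma sym_map_inverse:
  assumes f: "endo f" and g: "endo g" and fg: "\<And>w. w \<in> W \<Longrightarrow> f (g w) = w" and a: "a \<in> carrier A"
  shows "sym_map scale W f (sym_map scale W g a) = a"
proof -
  obtain p where p: "a = cls p" "mpoly_vars p \<subseteq> W" using a by (auto simp: carrier_A)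
  have "mpoly_subst (f \<circ> g) p = p"
    by (rule mpoly_subst_cong_id) (use p fg in auto)
  then show ?thesis
    using p subst_vars[OF g p(2)] by (simp add: sym_map_cls[OF f] sym_map_cls[OF g] mpoly_subst_compose)
qed

text \<open>
The image of a prime ideal under an automorphism is its preimage under the inverse automorphism.
\<close>

lemma sym_map_spec:
  assumes f: "endo f" and g: "endo g"
    and fg: "\<And>w. w \<in> W \<Longrightarrow> f (g w) = w" and gf: "\<And>w. w \<in> W \<Longrightarrow> g (f w) = w"
    and P: "P \<in> spec A"
  shows "sym_map scale W f ` P \<in> spec A"
proof -
  interpret P: primeideal P A using P by (simp add: spec_def)
  interpret ring_hom_ring A A "sym_map scale W g"
    by (intro ring_hom_ringI2 A.ring_axioms sym_map_hom[OF g])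
  have "sym_map scale W f ` P = {a \<in> carrier A. sym_map scale W g a \<in> P}" (is "?L = ?R")
  proof
    show "?L \<subseteq> ?R"
      using P.a_subset sym_map_inverse[OF g f gf] ring_hom_closed[OF sym_map_hom[OF f]] by auto
    show "?R \<subseteq> ?L"
    proof
      fix a assume "a \<in> ?R"
      then show "a \<in> ?L"
        using sym_map_inverse[OF f g fg, of a] by (intro image_eqI[of a _ "sym_map scale W g a"]) simp_all
    qed
  qed
  then show ?thesis
    using primeideal_vimage[OF A.is_cring P.primeideal_axioms] by (simp add: spec_def)
qed

section \<open>Functionals separate the elements of a symmetric algebra\<close>

text \<open>
Replacing every variable of a polynomial by something congruent to it does not change the class of the
polynomial. Applied to the expansion of the vectors of \<open>W\<close> in a basis, this gives the normal form of an
element of \<open>Sym(W)\<close> as a polynomial in basis vectors.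
\<close>

lemma eval_congruent:
  assumes x: "\<And>w. w \<in> W \<Longrightarrow> mpoly_vars (x w) \<subseteq> W" "\<And>w. w \<in> W \<Longrightarrow> mpoly_var w - x w \<in> I"
    and p: "mpoly_vars p \<subseteq> W"
  shows "p - mpoly_eval mpoly_const x p \<in> I"
proof -
  define C where "C a b \<longleftrightarrow> mpoly_vars a \<subseteq> W \<and> mpoly_vars b \<subseteq> W \<and> a - b \<in> I" for a b :: "('w, 'a) mpoly"
  have C_mult: "C (a * c) (b * d)" if "C a b" "C c d" for a b c d
  proof -
    have "a * c - b * d = c * (a - b) + b * (c - d)" by (simp add: algebra_simps)
    then show ?thesis using that by (simp add: C_def I_add I_mult)
  qed
  have C_add: "C (a + c) (b + d)" if "C a b" "C c d" for a b c d
  proof -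
    have "(a + c) - (b + d) = (a - b) + (c - d)" by simp
    moreover have "(a - b) + (c - d) \<in> I" using that I_add by (simp add: C_def)
    ultimately show ?thesis using that by (simp only: C_def mpoly_vars_closed simp_thms)
  qed
  have C_refl: "C a a" if "mpoly_vars a \<subseteq> W" for a
    using that by (simp add: C_def I_zero)
  have C_power: "C (a ^ n) (b ^ n)" if "C a b" for a b n
    using that by (induction n) (simp_all add: C_refl C_mult)
  have C_prod: "C (prod f S) (prod g S)" if "\<And>a. a \<in> S \<Longrightarrow> C (f a) (g a)" for f g :: "'w \<Rightarrow> ('w, 'a) mpoly" and S
    using that by (induction S rule: infinite_finite_induct) (simp_all add: C_refl C_mult)
  have C_sum: "C (sum f S) (sum g S)" if "\<And>a. a \<in> S \<Longrightarrow> C (f a) (g a)"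
    for f g :: "('w \<Rightarrow>\<^sub>0 nat) \<Rightarrow> ('w, 'a) mpoly" and S
    using that by (induction S rule: infinite_finite_induct) (simp_all add: C_refl C_add)
  have "C (mpoly_eval mpoly_const mpoly_var p) (mpoly_eval mpoly_const x p)"
    unfolding mpoly_eval_def
  proof (intro C_sum C_mult C_prod C_power C_refl)
    fix m w assume "m \<in> keys p" "w \<in> keys m"
    then have "w \<in> W" using p by (auto simp: mpoly_vars_def)
    then show "C (mpoly_var w) (x w)" using x by (simp add: C_def)
  qed simp
  then show ?thesis by (simp add: mpoly_eval_id C_def)
qed

lemma var_sum_congruent:
  assumes "finite S" "S \<subseteq> W"
  shows "mpoly_var (\<Sum>b\<in>S. scale (c b) b) - (\<Sum>b\<in>S. mpoly_const (c b) * mpoly_var b) \<in> I"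
  using assms
proof (induction S rule: finite_induct)
  case empty
  have "mpoly_var (scale 0 0) - mpoly_const 0 * mpoly_var 0 \<in> I"
    using relations_in_I subspace_0[OF subspace_W] by blast
  then show ?case by (simp add: mpoly_const_def)
next
  case (insert b S)
  let ?s = "\<Sum>b\<in>S. scale (c b) b" and ?t = "\<Sum>b\<in>S. mpoly_const (c b) * mpoly_var b"
  have b: "b \<in> W" using insert.prems by simp
  then have cb: "scale (c b) b \<in> W" by (rule subspace_scale[OF subspace_W])
  have s: "?s \<in> W"
    using insert.prems by (intro subspace_sum[OF subspace_W] subspace_scale[OF subspace_W]) auto
  have 1: "mpoly_var (scale (c b) b + ?s) - mpoly_var (scale (c b) b) - mpoly_var ?s \<in> I"
    using relations_in_I cb s by blast
  have 2: "mpoly_var (scale (c b) b) - mpoly_const (c b) * mpoly_var b \<in> I"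
    using relations_in_I b by blast
  have 3: "mpoly_var ?s - ?t \<in> I" using insert by simp
  have "mpoly_var (scale (c b) b + ?s) - (mpoly_const (c b) * mpoly_var b + ?t) =
      (mpoly_var (scale (c b) b + ?s) - mpoly_var (scale (c b) b) - mpoly_var ?s) +
      (mpoly_var (scale (c b) b) - mpoly_const (c b) * mpoly_var b) + (mpoly_var ?s - ?t)"
    by (simp add: algebra_simps)
  also have "\<dots> \<in> I" by (intro I_add 1 2 3)
  finally show ?case using insert.hyps by simp
qed

lemma functional_extend:
  assumes "independent B"
  obtains \<psi> where "functional \<psi>" "\<And>b. b \<in> B \<Longrightarrow> \<psi> b = f b"
proof -
  interpret vector_space_pair scale "(*) :: 'a \<Rightarrow> 'a \<Rightarrow> 'a"
    by unfold_locales (simp_all add: algebra_simps)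
  show ?thesis using linear_independent_extend[OF assms, of f] that by blast
qed

lemma functional_sum:
  assumes "functional \<psi>"
  shows "\<psi> (\<Sum>a\<in>S. scale (c a) (f a)) = (\<Sum>a\<in>S. c a * \<psi> (f a))"
proof -
  have "\<psi> 0 = 0" using functional_scale[OF assms, of 0 0] by simp
  then show ?thesis
    by (induction S rule: infinite_finite_induct)
      (simp_all add: functional_add[OF assms] functional_scale[OF assms])
qed

text \<open>
A class that is not zero has a nonzero representative in the variables of a basis of \<open>W\<close>. This
polynomial is nonzero at some assignment of values to the basis, and any such assignment extends to a linear
functional.
\<close>

theorem functionals_separate:
  assumes p: "mpoly_vars p \<subseteq> W" and nz: "p \<notin> I"
  obtains \<psi> where "functional \<psi>" "ev \<psi> p \<noteq> 0"
proof -
  obtain B where B: "B \<subseteq> W" "independent B" "W \<subseteq> span B"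
    using maximal_independent_subset[of W] by blast
  let ?r = "representation B"
  define x where "x w = (\<Sum>b | ?r w b \<noteq> 0. mpoly_const (?r w b) * mpoly_var b)" for w
  have fin: "finite {b. ?r w b \<noteq> 0}" and sub: "{b. ?r w b \<noteq> 0} \<subseteq> W" for w
    using finite_representation representation_ne_zero B(1) by blast+
  have rep: "(\<Sum>b | ?r w b \<noteq> 0. scale (?r w b) b) = w" if "w \<in> W" for w
    using sum_nonzero_representation_eq[OF B(2)] B(3) that by blast
  have x_vars: "mpoly_vars (x w) \<subseteq> W" for w
    unfolding x_def
  proof (rule mpoly_vars_sum)
    fix b assume "b \<in> {b. ?r w b \<noteq> 0}"
    then have "b \<in> W" using sub[of w] by blast
    then show "mpoly_vars (mpoly_const (?r w b) * mpoly_var b) \<subseteq> W" by simp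
  qed
  have "mpoly_var w - x w \<in> I" if "w \<in> W" for w
    using var_sum_congruent[OF fin[of w] sub[of w], of "?r w"] rep[OF that] by (simp add: x_def)
  then have cong: "p - mpoly_eval mpoly_const x p \<in> I"
    using eval_congruent x_vars p by blast
  then have "mpoly_eval mpoly_const x p \<noteq> 0" using nz by auto
  then obtain a where a: "ev a (mpoly_eval mpoly_const x p) \<noteq> 0"
    using mpoly_nonvanishing_point by blast
  obtain \<psi> where \<psi>: "functional \<psi>" "\<And>b. b \<in> B \<Longrightarrow> \<psi> b = a b"
    using functional_extend[OF B(2)] by blast
  have "ev a (x w) = \<psi> w" if "w \<in> W" for w
  proof -
    have "ev a (x w) = (\<Sum>b | ?r w b \<noteq> 0. ?r w b * \<psi> b)"
      unfolding x_def
      by (simp add: coeff_id.mpoly_eval_sum coeff_id.mpoly_eval_mult coeff_id.mpoly_eval_const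
          coeff_id.mpoly_eval_var) (intro sum.cong refl, use \<psi>(2) representation_ne_zero in auto)
    also have "\<dots> = \<psi> w"
      using functional_sum[OF \<psi>(1), of "?r w" "\<lambda>b. b" "{b. ?r w b \<noteq> 0}"] rep[OF that] by simp
    finally show ?thesis .
  qed
  then have "ev a (mpoly_eval mpoly_const x p) = ev \<psi> p"
    unfolding coeff_id.mpoly_eval_eval by (intro mpoly_eval_cong) (use p in auto)
  then show ?thesis using that \<psi>(1) a by simp
qed

end

section \<open>Generic points\<close>

locale sym_algebra_action = sym_algebra +
  fixes G :: "('b \<Rightarrow> 'b) set"
  assumes G_endo: "f \<in> G \<Longrightarrow> endo f"
    and G_inverse: "f \<in> G \<Longrightarrow> \<exists>g\<in>G. (\<forall>w\<in>W. f (g w) = w) \<and> (\<forall>w\<in>W. g (f w) = w)"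
begin

abbreviation "\<Gamma> \<equiv> (\<lambda>f. sym_map scale W f) ` G"

lemma spec_action: "f \<in> G \<Longrightarrow> P \<in> spec A \<Longrightarrow> sym_map scale W f ` P \<in> spec A"
  using G_inverse[of f] sym_map_spec[of f] G_endo by blast

text \<open>
A closed stable set \<open>Z\<close> through the point is the zero set of some \<open>S\<close>. Applying \<open>f\<inverse>\<close> to the point shows that
every element of \<open>S\<close> vanishes at \<open>\<phi> \<circ> f\<close>, for each \<open>f \<in> G\<close>; by density only zero does so, and \<open>Z\<close> is the
whole spectrum.
\<close>

lemma generic_if_orbit_dense:
  assumes \<phi>: "functional \<phi>"
    and dense: "\<And>p. mpoly_vars p \<subseteq> W \<Longrightarrow> p \<notin> I \<Longrightarrow> \<exists>f\<in>G. ev (\<phi> \<circ> f) p \<noteq> 0"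
  shows "generic A \<Gamma> (a_kernel A ring_of_type_algebra (point \<phi>))" (is "generic A \<Gamma> ?x")
proof -
  have x: "?x \<in> spec A" by (rule K_point_kernel_prime[OF point_hom[OF \<phi>]])
  have "Z = spec A" if Z: "zariski_closed A Z" "stable \<Gamma> Z" "?x \<in> Z" for Z
  proof -
    obtain S where S: "S \<subseteq> carrier A" "Z = {P \<in> spec A. S \<subseteq> P}"
      using Z(1) by (auto simp: zariski_closed_def)
    have "s = \<zero>\<^bsub>A\<^esub>" if "s \<in> S" for s
    proof -
      obtain p where p: "s = cls p" "mpoly_vars p \<subseteq> W"
        using subsetD[OF S(1) \<open>s \<in> S\<close>] by (auto simp: carrier_A)
      have "p \<in> I"
      proof (rule ccontr)
        assume "p \<notin> I"
        then obtain f where f: "f \<in> G" "ev (\<phi> \<circ> f) p \<noteq> 0" using dense p by blast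
        obtain g where g: "g \<in> G" "\<And>w. w \<in> W \<Longrightarrow> f (g w) = w" using G_inverse[OF f(1)] by blast
        have "sym_map scale W g ` ?x \<in> Z"
          using Z(2,3) g(1) by (auto simp: stable_def)
        then obtain a where a: "a \<in> ?x" "s = sym_map scale W g a" using S(2) \<open>s \<in> S\<close> by blast
        then obtain q where q: "a = cls q" "mpoly_vars q \<subseteq> W"
          by (auto simp: in_kernel_iff carrier_A)
        have q0: "ev \<phi> q = 0"
          using a(1) q point_cls[OF \<phi>] by (simp add: in_kernel_iff)
        have sg: "cls p = cls (mpoly_subst g q)"
          using a(2) p(1) q sym_map_cls[OF G_endo[OF g(1)]] by simp
        have "p - mpoly_subst g q \<in> I"
          using sg cls_eq_iff[OF p(2) subst_vars[OF G_endo[OF g(1)] q(2)]] by simp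
        moreover have "functional (\<phi> \<circ> f)"
          using \<phi> G_endo[OF f(1)] Vector_Spaces.linear_compose by blast
        ultimately have "ev (\<phi> \<circ> f) p = ev (\<phi> \<circ> f) (mpoly_subst g q)"
          using ev_I by (fastforce simp: coeff_id.mpoly_eval_diff)
        also have "\<dots> = ev \<phi> q"
          unfolding coeff_id.mpoly_eval_subst by (rule mpoly_eval_cong) (use q(2) g(2) in auto)
        finally show False using f(2) q0 by simp
      qed
      then show ?thesis using p cls_eq_iff[of p 0] by (simp add: zero_A)
    qed
    moreover have "\<zero>\<^bsub>A\<^esub> \<in> P" if "P \<in> spec A" for P
    proof -
      interpret primeideal P A using that by (simp add: spec_def)
      show ?thesis by simp
    qed
    ultimately show ?thesis using S(2) by blast
  qed
  moreover have "zariski_closed A (spec A)" "stable \<Gamma> (spec A)"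
    using spec_action by (auto simp: zariski_closed_def stable_def)
  ultimately have "orbit_closure A \<Gamma> ?x = spec A"
    unfolding orbit_closure_def using x by blast
  then show ?thesis using x by (simp add: generic_def)
qed

text \<open>
An invariant vector \<open>w\<close> is an invariant function, so the orbit closure lies in the proper closed subset where
\<open>w\<close> takes the same value \<open>c\<close> as at the given point.
\<close>

lemma not_generic_if_invariant_vector:
  assumes w: "w \<in> W" "w \<noteq> 0" "\<And>f. f \<in> G \<Longrightarrow> f w = w"
    and \<phi>: "\<phi> \<in> Ring.ring_hom A ring_of_type_algebra" "\<And>c. \<phi> (sym_const scale W c) = c"
  shows "\<not> generic A \<Gamma> (a_kernel A ring_of_type_algebra \<phi>)" (is "\<not> generic A \<Gamma> ?x")
proof
  assume gen: "generic A \<Gamma> ?x"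
  define c where "c = \<phi> (cls (mpoly_var w))"
  define p where "p = mpoly_var w - mpoly_const c"
  have p: "mpoly_vars p \<subseteq> W" using w(1) by (simp add: p_def)
  have "cls (mpoly_var w) = cls p \<oplus>\<^bsub>A\<^esub> sym_const scale W c"
    using w(1) by (simp add: p_def sym_const_def cls_add)
  then have "c = \<phi> (cls p \<oplus>\<^bsub>A\<^esub> sym_const scale W c)"
    by (simp add: c_def)
  also have "\<dots> = \<phi> (cls p) + c"
    using ring_hom_add[OF \<phi>(1), of "cls p" "sym_const scale W c"] \<phi>(2)[of c] p
    by (simp add: sym_const_def carrier_A ring_of_type_algebra_def)
  finally have p0: "\<phi> (cls p) = 0" by simp
  define Z where "Z = {P \<in> spec A. {cls p} \<subseteq> P}"
  have "zariski_closed A Z"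
    unfolding zariski_closed_def Z_def using p by (intro exI[of _ "{cls p}"]) (simp add: carrier_A)
  moreover have "stable \<Gamma> Z"
    unfolding stable_def
  proof safe
    fix f P assume f: "f \<in> G" and P: "P \<in> Z"
    have "sym_map scale W f (cls p) = cls p"
      using p w(3)[OF f] by (simp add: sym_map_cls[OF G_endo[OF f]] p_def mpoly_subst_eq_eval
          coeff_mpoly.mpoly_eval_diff coeff_mpoly.mpoly_eval_var coeff_mpoly.mpoly_eval_const)
    then show "sym_map scale W f ` P \<in> Z"
      using P spec_action[OF f] by (auto simp: Z_def intro: rev_image_eqI)
  qed
  moreover have "?x \<in> Z"
    using p p0 K_point_kernel_prime[OF \<phi>(1)] by (simp add: Z_def in_kernel_iff carrier_A)
  ultimately have "orbit_closure A \<Gamma> ?x \<subseteq> Z"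
    unfolding orbit_closure_def by blast
  then have all: "spec A \<subseteq> Z" using gen by (simp add: generic_def)
  \<comment> \<open>A point outside \<open>Z\<close>.\<close>
  obtain \<psi> where \<psi>: "functional \<psi>" "\<psi> w = c + 1"
    using functional_extend[of "{w}" "\<lambda>_. c + 1"] w(2) by auto
  then have "a_kernel A ring_of_type_algebra (point \<psi>) \<in> Z"
    using all K_point_kernel_prime[OF point_hom[OF \<psi>(1)]] by blast
  then have "ev \<psi> p = 0"
    using point_cls[OF \<psi>(1) p] by (simp add: Z_def in_kernel_iff)
  then show False
    using \<psi>(2) by (simp add: p_def coeff_id.mpoly_eval_diff coeff_id.mpoly_eval_var coeff_id.mpoly_eval_const)
qed

end

section \<open>Linear maps between spaces with a basis\<close>

lemma lookup_vscale [simp]: "lookup (vscale c v) i = c * lookup v i"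
  by (simp add: vscale_def map.rep_eq when_def)

interpretation vs: vector_space "vscale :: 'a::field \<Rightarrow> ('i \<Rightarrow>\<^sub>0 'a) \<Rightarrow> ('i \<Rightarrow>\<^sub>0 'a)"
  by unfold_locales (auto intro!: poly_mapping_eqI simp: lookup_add algebra_simps)

abbreviation vlinear :: "(('i \<Rightarrow>\<^sub>0 'a) \<Rightarrow> ('j \<Rightarrow>\<^sub>0 'a::field)) \<Rightarrow> bool" where
  "vlinear \<equiv> Vector_Spaces.linear vscale vscale"

lemma vlinearI:
  assumes "\<And>u v. f (u + v) = f u + f v" "\<And>c v. f (vscale c v) = vscale c (f v)"
  shows "vlinear f"
  unfolding Vector_Spaces.linear_iff by (simp add: assms vs.vector_space_axioms)

lemma vlinear_add: "vlinear f \<Longrightarrow> f (u + v) = f u + f v"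
  by (simp add: Vector_Spaces.linear_iff)

lemma vlinear_scale: "vlinear f \<Longrightarrow> f (vscale c v) = vscale c (f v)"
  by (simp add: Vector_Spaces.linear_iff)

lemma vlinear_zero: "vlinear f \<Longrightarrow> f 0 = 0"
  using vlinear_scale[of f 0 0] by simp

lemma vlinear_sum: "vlinear f \<Longrightarrow> f (sum g A) = (\<Sum>a\<in>A. f (g a))"
  by (induction A rule: infinite_finite_induct) (simp_all add: vlinear_zero vlinear_add)

lemma vlinear_compose: "vlinear f \<Longrightarrow> vlinear g \<Longrightarrow> vlinear (\<lambda>v. f (g v))"
  by (rule vlinearI) (simp_all add: vlinear_add vlinear_scale)

lemma lookup_lin_ext: "lookup (lin_ext b v) j = (\<Sum>i\<in>keys v. lookup v i * lookup (b i) j)"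
  by (simp add: lin_ext_def lookup_sum)

lemma lin_ext_superset:
  assumes "finite S" "keys v \<subseteq> S"
  shows "lin_ext b v = (\<Sum>i\<in>S. vscale (lookup v i) (b i))"
  unfolding lin_ext_def by (rule sum.mono_neutral_left) (use assms in \<open>auto simp: in_keys_iff\<close>)

lemma vlinear_lin_ext:
  fixes b :: "'i \<Rightarrow> ('j \<Rightarrow>\<^sub>0 'a::field)"
  shows "vlinear (lin_ext b)"
proof (rule vlinearI)
  fix u v :: "'i \<Rightarrow>\<^sub>0 'a"
  let ?S = "keys u \<union> keys v"
  show "lin_ext b (u + v) = lin_ext b u + lin_ext b v"
    using keys_add[of u v]
    by (simp add: lin_ext_superset[of ?S] lookup_add vs.scale_left_distrib sum.distrib)
next
  fix c and v :: "'i \<Rightarrow>\<^sub>0 'a"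
  have "keys (vscale c v) \<subseteq> keys v" by (auto simp: in_keys_iff)
  then show "lin_ext b (vscale c v) = vscale c (lin_ext b v)"
    by (simp add: lin_ext_superset[of "keys v"] vs.scale_sum_right)
qed

lemma lin_ext_single [simp]: "lin_ext b (single i c) = vscale c (b i)"
  by (simp add: lin_ext_def)

lemma vscale_single [simp]: "vscale c (single i d) = single i (c * d)"
  by (rule poly_mapping_eqI) (simp add: lookup_single when_def)

lemma basis_expansion: "(\<Sum>i\<in>keys v. vscale (lookup v i) (single i 1)) = v"
  by (simp add: poly_mapping_sum_single)

lemma vlinear_expand:
  assumes "vlinear f"
  shows "f v = (\<Sum>i\<in>keys v. vscale (lookup v i) (f (single i 1)))"
proof -
  have "f v = f (\<Sum>i\<in>keys v. vscale (lookup v i) (single i 1))" by (simp only: basis_expansion)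
  then show ?thesis by (simp only: vlinear_sum[OF assms] vlinear_scale[OF assms])
qed

lemma vlinear_eqI:
  assumes "vlinear f" "vlinear g" "\<And>i. i \<in> keys v \<Longrightarrow> f (single i 1) = g (single i 1)"
  shows "f v = g v"
  using assms(3) by (simp add: vlinear_expand[OF assms(1), of v] vlinear_expand[OF assms(2), of v])

section \<open>The group GL\<close>

lemma vlinear_gl_map: "vlinear (gl_map n M)"
  unfolding gl_map_def by (rule vlinear_lin_ext)

lemma gl_map_single:
  "gl_map n M (single j 1) = (if j < n then (\<Sum>i<n. single i (M $$ (i, j))) else single j 1)"
  by (simp add: gl_map_def)

lemma gl_map_mult:
  assumes M: "M \<in> carrier_mat n n" and N: "N \<in> carrier_mat n n"
  shows "gl_map n M (gl_map n N v) = gl_map n (M * N) v"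
proof (rule vlinear_eqI[of "\<lambda>v. gl_map n M (gl_map n N v)" "gl_map n (M * N)"])
  fix j
  show "gl_map n M (gl_map n N (single j 1)) = gl_map n (M * N) (single j 1)"
  proof (cases "j < n")
    case True
    have "gl_map n M (gl_map n N (single j 1)) =
        (\<Sum>k<n. vscale (N $$ (k, j)) (gl_map n M (single k 1)))"
      using True by (simp add: gl_map_single[of n N] vlinear_sum[OF vlinear_gl_map]
          flip: vlinear_scale[OF vlinear_gl_map])
    also have "\<dots> = (\<Sum>k<n. \<Sum>i<n. single i (M $$ (i, k) * N $$ (k, j)))"
      by (intro sum.cong refl) (simp add: gl_map_single vs.scale_sum_right mult.commute)
    also have "\<dots> = (\<Sum>i<n. \<Sum>k<n. single i (M $$ (i, k) * N $$ (k, j)))"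
      by (rule sum.swap)
    also have "\<dots> = (\<Sum>i<n. single i ((M * N) $$ (i, j)))"
    proof (intro sum.cong refl)
      fix i assume "i \<in> {..<n}"
      then have "(M * N) $$ (i, j) = (\<Sum>k<n. M $$ (i, k) * N $$ (k, j))"
        using M N True by (auto simp: scalar_prod_def atLeast0LessThan intro!: sum.cong)
      moreover have "single i (sum f S) = (\<Sum>k\<in>S. single i (f k :: 'a))" for f and S :: "nat set"
        by (induction S rule: infinite_finite_induct) (simp_all add: single_add)
      ultimately show "(\<Sum>k<n. single i (M $$ (i, k) * N $$ (k, j))) = single i ((M * N) $$ (i, j))"
        by simp
    qed
    finally show ?thesis using True by (simp add: gl_map_single)
  qed (simp add: gl_map_single)
qed (rule vlinear_gl_map vlinear_compose[OF vlinear_gl_map vlinear_gl_map])+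

lemma gl_map_one: "gl_map n (1\<^sub>m n) v = v"
proof (rule vlinear_eqI[of "gl_map n (1\<^sub>m n)" "\<lambda>v. v"])
  fix j
  have "(\<Sum>i<n. single i ((1\<^sub>m n :: 'a mat) $$ (i, j))) = single j 1" if "j < n"
  proof -
    have "(\<Sum>i<n. single i ((1\<^sub>m n :: 'a mat) $$ (i, j))) = (\<Sum>i<n. if i = j then single j 1 else 0)"
      using that by (intro sum.cong refl) auto
    then show ?thesis using that by simp
  qed
  then show "gl_map n (1\<^sub>m n :: 'a mat) (single j 1) = single j 1"
    by (simp add: gl_map_single)
qed (simp_all add: vlinear_gl_map vlinearI)

lemma GL_I:
  assumes "n \<ge> 1" "M \<in> carrier_mat n n" "N \<in> carrier_mat n n" "M * N = 1\<^sub>m n" "N * M = 1\<^sub>m n"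
  shows "gl_map n M \<in> GL"
proof -
  have "invertible_mat M"
    unfolding invertible_mat_def inverts_mat_def using assms by auto
  then show ?thesis using assms unfolding GL_def by blast
qed

lemma GL_vlinear: "g \<in> GL \<Longrightarrow> vlinear g"
  by (auto simp: GL_def vlinear_gl_map)

lemma GL_inverse:
  assumes "g \<in> GL"
  obtains g' where "g' \<in> GL" "\<And>v. g (g' v) = v" "\<And>v. g' (g v) = v"
proof -
  obtain n M where M: "n \<ge> 1" "g = gl_map n M" "M \<in> carrier_mat n n" "invertible_mat M"
    using assms by (auto simp: GL_def)
  then obtain N where "inverts_mat M N" "inverts_mat N M"
    by (auto simp: invertible_mat_def)
  then have MN: "M * N = 1\<^sub>m n" and NM: "N * M = 1\<^sub>m (dim_row N)"
    using M by (auto simp: inverts_mat_def)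
  have "dim_col N = n" using arg_cong[OF MN, of dim_col] by simp
  moreover have "dim_row N = n" using arg_cong[OF NM, of dim_col] M(3) by simp
  ultimately have N: "N \<in> carrier_mat n n" by auto
  show ?thesis
  proof (rule that[of "gl_map n N"])
    show "gl_map n N \<in> GL" using GL_I[of n N M] M N MN NM by simp
  qed (use M N MN NM in \<open>simp_all add: gl_map_mult gl_map_one\<close>)
qed

text \<open>
The inverse of \<open>e\<^sub>j \<mapsto> e\<^sub>j + x\<^sub>j\<close> is \<open>e\<^sub>j \<mapsto> e\<^sub>j - x\<^sub>j\<close>: the basis vectors that occur in the \<open>x\<^sub>j\<close> are fixed, so
the matrix \<open>N\<close> of \<open>e\<^sub>j \<mapsto> x\<^sub>j\<close> has square zero and \<open>1 + a N\<close> is additive in \<open>a\<close>.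
\<close>

lemma unipotent_in_GL:
  fixes x :: "nat \<Rightarrow> 'a::field stdrep"
  assumes x: "\<And>j. j < n \<Longrightarrow> keys (x j) \<subseteq> {n..}"
  shows "\<exists>u\<in>GL. \<forall>j<n. u (single j 1) = single j 1 + x j"
proof -
  define m where "m = Suc (n + Max (insert 0 (\<Union>j<n. keys (x j))))"
  have m: "n < m" "\<And>j i. j < n \<Longrightarrow> i \<in> keys (x j) \<Longrightarrow> i < m"
  proof -
    show "n < m" by (simp add: m_def)
    fix j i assume "j < n" "i \<in> keys (x j)"
    then have "i \<le> Max (insert 0 (\<Union>j<n. keys (x j)))" by (intro Max_ge) auto
    then show "i < m" by (simp add: m_def)
  qed
  define N where "N i j = (if j < n then lookup (x j) i else 0)" for i j
  have NN: "N i k * N k j = 0" for i j k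
  proof (cases "k < n \<and> j < n")
    case True
    then have "k \<notin> keys (x j)" using x[of j] by auto
    then show ?thesis by (simp add: N_def in_keys_iff)
  qed (auto simp: N_def)
  define E where "E a = mat m m (\<lambda>(i, j). (if i = j then 1 else 0) + a * N i j)" for a
  have E: "E a \<in> carrier_mat m m" for a by (simp add: E_def)
  have E_mult: "E a * E b = E (a + b)" for a b
  proof (rule eq_matI)
    fix i j assume "i < dim_row (E (a + b))" "j < dim_col (E (a + b))"
    then have ij: "i < m" "j < m" by (simp_all add: E_def)
    have "(E a * E b) $$ (i, j) = (\<Sum>k<m. ((if i = k then 1 else 0) + a * N i k) * ((if k = j then 1 else 0) + b * N k j))"
      using ij by (simp add: E_def scalar_prod_def atLeast0LessThan)
    also have "\<dots> = (\<Sum>k<m. (if k = i then (if i = j then 1 else 0) + b * N i j else 0) + (if k = j then a * N i j else 0))"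
    proof (intro sum.cong refl)
      fix k
      have "a * N i k * (b * N k j) = 0" using NN[of i k j] by auto
      then show "((if i = k then 1 else 0) + a * N i k) * ((if k = j then 1 else 0) + b * N k j) =
        (if k = i then (if i = j then 1 else 0) + b * N i j else 0) + (if k = j then a * N i j else 0)"
        by (auto simp: algebra_simps)
    qed
    also have "\<dots> = (if i = j then 1 else 0) + b * N i j + a * N i j"
      using ij by (simp add: sum.distrib)
    also have "\<dots> = E (a + b) $$ (i, j)"
      using ij by (simp add: E_def algebra_simps)
    finally show "(E a * E b) $$ (i, j) = E (a + b) $$ (i, j)" .
  qed (simp_all add: E_def)
  have E_0: "E 0 = 1\<^sub>m m" by (rule eq_matI) (simp_all add: E_def)
  have "gl_map m (E 1) \<in> GL"
    by (rule GL_I[of m "E 1" "E (- 1)"]) (use m(1) in \<open>simp_all add: E E_mult E_0\<close>)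
  moreover have "gl_map m (E 1) (single j 1) = single j 1 + x j" if "j < n" for j
  proof (rule poly_mapping_eqI)
    fix l
    have j: "j < m" using that m(1) by simp
    have "lookup (gl_map m (E 1) (single j 1)) l = (\<Sum>i<m. if i = l then E 1 $$ (l, j) else 0)"
      using j unfolding gl_map_single by (auto simp: lookup_sum lookup_single when_def intro!: sum.cong)
    also have "\<dots> = (if l < m then E 1 $$ (l, j) else 0)" by simp
    also have "\<dots> = lookup (single j 1 + x j) l"
      using j that m(2)[of j l] by (auto simp: E_def N_def lookup_add lookup_single when_def in_keys_iff)
    finally show "lookup (gl_map m (E 1) (single j 1)) l = lookup (single j 1 + x j) l" .
  qed
  ultimately show ?thesis by blast
qed

section \<open>Tensor powers and Schur functors\<close>

text \<open>
The tensor product of a vector with a tensor. Its bilinearity makes the functoriality of \<^const>\<open>tensor_map\<close>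
an induction on the tensor degree.
\<close>

definition tcons :: "'a stdrep \<Rightarrow> 'a tensor \<Rightarrow> 'a::field tensor" where
  "tcons v t = (\<Sum>i\<in>keys v. \<Sum>ks\<in>keys t. single (i # ks) (lookup v i * lookup t ks))"

lemma pure_tensor_Cons: "pure_tensor (v # vs) = tcons v (pure_tensor vs)"
  by (simp add: tcons_def)

lemma lookup_tcons_Nil [simp]: "lookup (tcons v t) [] = 0"
  by (simp add: tcons_def lookup_sum lookup_single)

lemma lookup_tcons_Cons [simp]: "lookup (tcons v t) (j # js) = lookup v j * lookup t js"
proof -
  have "lookup (tcons v t) (j # js) =
      (\<Sum>i\<in>keys v. \<Sum>ks\<in>keys t. if j = i then if js = ks then lookup v j * lookup t js else 0 else 0)"
    unfolding tcons_def lookup_sum by (intro sum.cong refl) (simp add: lookup_single when_def)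
  also have "\<dots> = (\<Sum>i\<in>keys v. if j = i then \<Sum>ks\<in>keys t. if js = ks then lookup v j * lookup t js else 0 else 0)"
    by (intro sum.cong refl) simp
  also have "\<dots> = lookup v j * lookup t js"
    by (simp add: in_keys_iff)
  finally show ?thesis .
qed

lemma tensor_eqI:
  assumes "lookup s [] = lookup t []" "\<And>j js. lookup s (j # js) = lookup t (j # js)"
  shows "s = t"
  by (rule poly_mapping_eqI) (metis assms list.exhaust)

lemma vlinear_tcons_left: "vlinear (\<lambda>v. tcons v t)"
  by (rule vlinearI; rule tensor_eqI) (simp_all add: lookup_add algebra_simps)

lemma vlinear_tcons_right: "vlinear (tcons v)"
  by (rule vlinearI; rule tensor_eqI) (simp_all add: lookup_add algebra_simps)

lemma tcons_single: "tcons (single i 1) (single ks 1) = single (i # ks) 1"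
  by (rule tensor_eqI) (simp_all add: lookup_single when_def)

lemma vlinear_tensor_map: "vlinear (tensor_map g)"
  unfolding tensor_map_def by (rule vlinear_lin_ext)

lemma tensor_map_single:
  "tensor_map g (single js 1) = pure_tensor (map (\<lambda>j. g (single j 1)) js)"
  by (simp add: tensor_map_def)

lemma tensor_map_tcons:
  assumes g: "vlinear g"
  shows "tensor_map g (tcons v t) = tcons (g v) (tensor_map g t)"
proof (rule vlinear_eqI[of "\<lambda>v. tensor_map g (tcons v t)" "\<lambda>v. tcons (g v) (tensor_map g t)"])
  fix i
  show "tensor_map g (tcons (single i 1) t) = tcons (g (single i 1)) (tensor_map g t)"
  proof (rule vlinear_eqI[of "\<lambda>t. tensor_map g (tcons (single i 1) t)" "\<lambda>t. tcons (g (single i 1)) (tensor_map g t)"])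
    fix ks
    show "tensor_map g (tcons (single i 1) (single ks 1)) = tcons (g (single i 1)) (tensor_map g (single ks 1))"
      by (simp add: tcons_single tensor_map_single pure_tensor_Cons del: pure_tensor.simps)
  qed (rule vlinear_compose[OF vlinear_tensor_map vlinear_tcons_right]
      vlinear_compose[OF vlinear_tcons_right vlinear_tensor_map])+
qed (rule vlinear_compose[OF vlinear_tensor_map vlinear_tcons_left]
      vlinear_compose[OF vlinear_tcons_left g])+

lemma tensor_map_compose:
  assumes g: "vlinear g"
  shows "tensor_map g (tensor_map h t) = tensor_map (g \<circ> h) t"
proof (rule vlinear_eqI[of "\<lambda>t. tensor_map g (tensor_map h t)" "tensor_map (g \<circ> h)"])
  fix js
  show "tensor_map g (tensor_map h (single js 1)) = tensor_map (g \<circ> h) (single js 1)"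
    unfolding tensor_map_single[of h] tensor_map_single[of "g \<circ> h"]
  proof (induction js)
    case Nil
    then show ?case using tensor_map_single[of g "[]"] by simp
  next
    case (Cons j js)
    then show ?case
      by (simp add: pure_tensor_Cons tensor_map_tcons[OF g] del: pure_tensor.simps)
  qed
qed (rule vlinear_tensor_map vlinear_compose[OF vlinear_tensor_map vlinear_tensor_map])+

lemma tensor_map_id: "tensor_map (\<lambda>v. v) t = t"
proof (rule vlinear_eqI[of "tensor_map (\<lambda>v. v)" "\<lambda>t. t"])
  fix js
  show "tensor_map (\<lambda>v. v) (single js 1) = (single js 1 :: 'a tensor)"
    unfolding tensor_map_single
  proof (induction js)
    case (Cons j js)
    then show ?case by (simp add: pure_tensor_Cons tcons_single del: pure_tensor.simps(2))
  qed simp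
qed (simp_all add: vlinear_tensor_map vlinearI)

lemma lookup_pure_tensor:
  "lookup (pure_tensor vs) ks =
    (if length ks = length vs then \<Prod>k<length vs. lookup (vs ! k) (ks ! k) else 0)"
proof (induction vs arbitrary: ks)
  case Nil
  then show ?case by (auto simp: lookup_single when_def)
next
  case (Cons v vs)
  show ?case
  proof (cases ks)
    case Nil
    then show ?thesis by (simp add: pure_tensor_Cons del: pure_tensor.simps)
  next
    case (Cons j js)
    then show ?thesis
      by (simp add: pure_tensor_Cons Cons.IH prod.lessThan_Suc_shift del: pure_tensor.simps prod.lessThan_Suc)
  qed
qed

lemma subspace_tensor_power: "vs.subspace (tensor_power d)"
  unfolding tensor_power_def
proof (rule vs.subspaceI)
  fix x y :: "'a tensor"
  assume "x \<in> {t. \<forall>js\<in>keys t. length js = d}" "y \<in> {t. \<forall>js\<in>keys t. length js = d}"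
  then show "x + y \<in> {t. \<forall>js\<in>keys t. length js = d}"
    using keys_add[of x y] by auto
qed (auto simp: in_keys_iff)

lemma pure_tensor_power: "pure_tensor vs \<in> tensor_power (length vs)"
  by (auto simp: tensor_power_def in_keys_iff lookup_pure_tensor split: if_splits)

lemma tensor_map_power: "t \<in> tensor_power d \<Longrightarrow> tensor_map g t \<in> tensor_power d"
  unfolding vlinear_expand[OF vlinear_tensor_map, of g t] tensor_map_single
  by (intro vs.subspace_sum[OF subspace_tensor_power] vs.subspace_scale[OF subspace_tensor_power])
    (use pure_tensor_power[of "map _ _"] in \<open>fastforce simp: tensor_power_def\<close>)

text \<open>
The right action of the symmetric group on tensors, from which the Young symmetrizer is built. It commutes
with every \<^const>\<open>tensor_map\<close>, and therefore so does the symmetrizer.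
\<close>

definition tensor_perm :: "(nat \<Rightarrow> nat) \<Rightarrow> 'a tensor \<Rightarrow> 'a::field tensor" where
  "tensor_perm \<sigma> = lin_ext (\<lambda>js. single (permute_list \<sigma> js) 1)"

lemma vlinear_tensor_perm: "vlinear (tensor_perm \<sigma>)"
  unfolding tensor_perm_def by (rule vlinear_lin_ext)

text \<open>
Comparing coefficients, this is a reindexing of the product of the coordinates of the factors.
\<close>

lemma tensor_perm_pure_tensor:
  assumes \<sigma>: "\<sigma> permutes {..<length vs}"
  shows "tensor_perm \<sigma> (pure_tensor vs) = pure_tensor (permute_list \<sigma> vs)"
proof (rule poly_mapping_eqI)
  fix ks
  let ?t = "pure_tensor vs" and ?d = "length vs" and ?i = "Hilbert_Choice.inv \<sigma>"
  have len: "length ls = ?d" if "ls \<in> keys ?t" for ls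
    using that pure_tensor_power[of vs] by (simp add: tensor_power_def)
  have iperm: "?i permutes {..<?d}" using \<sigma> by (rule permutes_inv)
  have *: "permute_list \<sigma> ls = ks \<longleftrightarrow> length ks = ?d \<and> ls = permute_list (?i) ks" if "ls \<in> keys ?t" for ls
  proof
    assume "permute_list \<sigma> ls = ks"
    then show "length ks = ?d \<and> ls = permute_list (?i) ks"
      using len[OF that] permute_list_compose[of "?i" ls \<sigma>] iperm \<sigma>
      by (auto simp: permutes_inv_o)
  next
    assume "length ks = ?d \<and> ls = permute_list (?i) ks"
    then show "permute_list \<sigma> ls = ks"
      using permute_list_compose[of \<sigma> ks "?i"] \<sigma> by (auto simp: permutes_inv_o)
  qed
  have "lookup (tensor_perm \<sigma> ?t) ks =
      (\<Sum>ls\<in>keys ?t. if length ks = ?d \<and> ls = permute_list (?i) ks then lookup ?t ls else 0)"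
    unfolding tensor_perm_def lookup_lin_ext by (intro sum.cong refl) (simp add: lookup_single when_def *)
  also have "\<dots> = (if length ks = ?d then lookup ?t (permute_list (?i) ks) else 0)"
    by (simp add: in_keys_iff)
  also have "\<dots> = lookup (pure_tensor (permute_list \<sigma> vs)) ks"
  proof (cases "length ks = ?d")
    case True
    have "lookup ?t (permute_list (?i) ks) = (\<Prod>k<?d. lookup (vs ! k) (ks ! ?i k))"
      using True iperm by (auto simp: lookup_pure_tensor permute_list_nth intro!: prod.cong)
    also have "\<dots> = (\<Prod>k<?d. lookup (vs ! \<sigma> k) (ks ! k))"
      by (subst prod.permute[OF \<sigma>]) (simp add: o_def permutes_inverses[OF \<sigma>])
    also have "\<dots> = lookup (pure_tensor (permute_list \<sigma> vs)) ks"
      using True \<sigma> by (auto simp: lookup_pure_tensor permute_list_nth intro!: prod.cong)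
    finally show ?thesis using True by simp
  qed (simp add: lookup_pure_tensor)
  finally show "lookup (tensor_perm \<sigma> ?t) ks = lookup (pure_tensor (permute_list \<sigma> vs)) ks" .
qed

lemma tensor_map_perm:
  assumes t: "t \<in> tensor_power d" and \<sigma>: "\<sigma> permutes {..<d}"
  shows "tensor_map g (tensor_perm \<sigma> t) = tensor_perm \<sigma> (tensor_map g t)"
proof (rule vlinear_eqI[of "\<lambda>t. tensor_map g (tensor_perm \<sigma> t)" "\<lambda>t. tensor_perm \<sigma> (tensor_map g t)"])
  fix js assume "js \<in> keys t"
  then have "length js = d" using t by (simp add: tensor_power_def)
  then have "permute_list \<sigma> (map (\<lambda>j. g (single j 1)) js) = map (\<lambda>j. g (single j 1)) (permute_list \<sigma> js)"
    using \<sigma> by (intro permute_list_map) simp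
  then show "tensor_map g (tensor_perm \<sigma> (single js 1)) = tensor_perm \<sigma> (tensor_map g (single js 1))"
    using tensor_perm_pure_tensor[of \<sigma> "map (\<lambda>j. g (single j 1)) js"] \<sigma> \<open>length js = d\<close>
    by (simp add: tensor_perm_def tensor_map_single)
qed (rule vlinear_compose[OF vlinear_tensor_map vlinear_tensor_perm]
    vlinear_compose[OF vlinear_tensor_perm vlinear_tensor_map])+

lemma young_symmetrizer_eq:
  "young_symmetrizer \<mu> t =
    (\<Sum>p\<in>row_group \<mu>. \<Sum>q\<in>col_group \<mu>. vscale (of_int (sign q)) (tensor_perm (p \<circ> q) t))"
proof (rule vlinear_eqI[of "young_symmetrizer \<mu>"])
  show "vlinear (\<lambda>t. \<Sum>p\<in>row_group \<mu>. \<Sum>q\<in>col_group \<mu>. vscale (of_int (sign q)) (tensor_perm (p \<circ> q) t))"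
    by (rule vlinearI) (simp_all add: vlinear_add[OF vlinear_tensor_perm] vlinear_scale[OF vlinear_tensor_perm]
        vs.scale_right_distrib sum.distrib vs.scale_sum_right mult.commute)
qed (simp_all add: young_symmetrizer_def tensor_perm_def vlinear_lin_ext o_def)

lemma vlinear_young_symmetrizer: "vlinear (young_symmetrizer \<mu>)"
  unfolding young_symmetrizer_def by (rule vlinear_lin_ext)

lemma tensor_map_young_symmetrizer:
  assumes "t \<in> tensor_power (sum_list \<mu>)"
  shows "tensor_map g (young_symmetrizer \<mu> t) = young_symmetrizer \<mu> (tensor_map g t)"
  unfolding young_symmetrizer_eq
  by (simp add: vlinear_sum[OF vlinear_tensor_map] vlinear_scale[OF vlinear_tensor_map])
    (intro sum.cong refl arg_cong2[where f = vscale] tensor_map_perm[OF assms] permutes_compose,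
      auto simp: row_group_def col_group_def)

lemma tensor_map_schur: "t \<in> schur \<mu> \<Longrightarrow> tensor_map g t \<in> schur \<mu>"
  unfolding schur_def using tensor_map_young_symmetrizer tensor_map_power by blast

lemma subspace_schur: "vs.subspace (schur \<mu>)"
proof (rule vs.subspaceI)
  note sub = subspace_tensor_power[of "sum_list \<mu>"]
  show "0 \<in> schur \<mu>"
    unfolding schur_def using vlinear_zero[OF vlinear_young_symmetrizer, of \<mu>] vs.subspace_0[OF sub]
    by (auto intro: rev_image_eqI)
  fix x y :: "'a tensor" and c assume "x \<in> schur \<mu>" "y \<in> schur \<mu>"
  then obtain s t where "x = young_symmetrizer \<mu> s" "s \<in> tensor_power (sum_list \<mu>)"
      "y = young_symmetrizer \<mu> t" "t \<in> tensor_power (sum_list \<mu>)"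
    by (auto simp: schur_def)
  then show "x + y \<in> schur \<mu>" "vscale c x \<in> schur \<mu>"
    unfolding schur_def
    by (auto simp flip: vlinear_add[OF vlinear_young_symmetrizer] vlinear_scale[OF vlinear_young_symmetrizer]
        intro!: imageI vs.subspace_add[OF sub] vs.subspace_scale[OF sub])
qed

lemma schur_length:
  assumes "t \<in> schur \<mu>" "js \<in> keys t"
  shows "length js = sum_list \<mu>"
proof -
  obtain s where s: "s \<in> tensor_power (sum_list \<mu>)" "t = young_symmetrizer \<mu> s"
    using assms(1) by (auto simp: schur_def)
  have "tensor_perm \<sigma> s \<in> tensor_power (sum_list \<mu>)" for \<sigma>
    unfolding vlinear_expand[OF vlinear_tensor_perm, of \<sigma> s]
    by (intro vs.subspace_sum[OF subspace_tensor_power] vs.subspace_scale[OF subspace_tensor_power])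
      (use s(1) in \<open>auto simp: tensor_power_def tensor_perm_def\<close>)
  then have "t \<in> tensor_power (sum_list \<mu>)"
    unfolding s(2) young_symmetrizer_eq
    by (intro vs.subspace_sum[OF subspace_tensor_power] vs.subspace_scale[OF subspace_tensor_power])
  then show ?thesis using assms(2) by (simp add: tensor_power_def)
qed

text \<open>
The Schur functor of the empty partition is the trivial one-dimensional representation.
\<close>

lemma single_Nil_in_schur: "single [] 1 \<in> schur []"
proof -
  have "row_group [] = {id}" "col_group [] = {id}"
    by (auto simp: row_group_def col_group_def)
  then have "young_symmetrizer [] (single [] 1 :: 'a tensor) = single [] 1"
    by (simp add: young_symmetrizer_def sign_id)
  moreover have "single [] 1 \<in> tensor_power (sum_list [])"
    by (simp add: tensor_power_def)
  ultimately show ?thesis unfolding schur_def by (metis image_eqI)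
qed

section \<open>The representation attached to a tuple\<close>

lemma lookup_tuple_scale [simp]: "lookup (tuple_scale c w) i = vscale c (lookup w i)"
  by (simp add: tuple_scale_def map.rep_eq when_def)

lemma lookup_tuple_act [simp]: "lookup (tuple_act g w) i = tensor_map g (lookup w i)"
  by (simp add: tuple_act_def map.rep_eq when_def vlinear_zero[OF vlinear_tensor_map])

interpretation tv: vector_space "tuple_scale :: 'a::field \<Rightarrow> 'a tuple_vec \<Rightarrow> 'a tuple_vec"
  by unfold_locales
    (auto intro!: poly_mapping_eqI[where 'b = "'a tensor"] simp: lookup_add vs.scale_right_distrib vs.scale_left_distrib)

lemma tuple_act_linear: "Vector_Spaces.linear tuple_scale tuple_scale (tuple_act g)"
  unfolding Vector_Spaces.linear_iff
  by (auto intro!: poly_mapping_eqI[where 'b = "'a tensor"] tv.vector_space_axioms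
      simp: lookup_add vlinear_add[OF vlinear_tensor_map] vlinear_scale[OF vlinear_tensor_map])

lemma tuple_act_inverse:
  assumes "vlinear g" "\<And>v. g (h v) = v"
  shows "tuple_act g (tuple_act h w) = w"
proof -
  have "g \<circ> h = (\<lambda>v. v)" using assms(2) by auto
  then show ?thesis
    by (intro poly_mapping_eqI) (simp add: tensor_map_compose[OF assms(1)] tensor_map_id)
qed

lemma subspace_tuple_rep: "tv.subspace (tuple_rep lam :: 'a::field tuple_vec set)"
proof -
  define S where "S i = (if i < length lam then schur (lam ! i) else {0} :: 'a tensor set)" for i
  have S: "vs.subspace (S i)" for i
    by (simp add: S_def subspace_schur vs.subspace_single_0)
  have rep: "w \<in> tuple_rep lam \<longleftrightarrow> (\<forall>i. lookup w i \<in> S i)" for w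
    by (simp add: tuple_rep_def S_def)
  show ?thesis
    by (rule tv.subspaceI; unfold rep lookup_zero lookup_add lookup_tuple_scale)
      (blast intro: vs.subspace_0[OF S] vs.subspace_add[OF S] vs.subspace_scale[OF S])+
qed

lemma tuple_act_rep: "w \<in> tuple_rep lam \<Longrightarrow> tuple_act g w \<in> tuple_rep lam"
  by (auto simp: tuple_rep_def tensor_map_schur vlinear_zero[OF vlinear_tensor_map] split: if_splits)

section \<open>Functionals on tuples\<close>

definition tuple_functional :: "(nat \<times> nat list \<Rightarrow> 'a) \<Rightarrow> 'a tuple_vec \<Rightarrow> 'a::field" where
  "tuple_functional c w = (\<Sum>i\<in>keys w. \<Sum>js\<in>keys (lookup w i). lookup (lookup w i) js * c (i, js))"

definition tuple_support :: "'a::field tuple_vec \<Rightarrow> (nat \<times> nat list) set" where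
  "tuple_support w = (SIGMA i:keys w. keys (lookup w i))"

lemma finite_tuple_support: "finite (tuple_support w)"
  by (simp add: tuple_support_def)

lemma in_tuple_support_iff: "(i, js) \<in> tuple_support w \<longleftrightarrow> lookup (lookup w i) js \<noteq> 0"
  by (auto simp: tuple_support_def in_keys_iff)

lemma tuple_functional_superset:
  assumes "finite S" "tuple_support w \<subseteq> S"
  shows "tuple_functional c w = (\<Sum>b\<in>S. lookup (lookup w (fst b)) (snd b) * c b)"
proof -
  have "tuple_functional c w = (\<Sum>b\<in>tuple_support w. lookup (lookup w (fst b)) (snd b) * c b)"
    unfolding tuple_functional_def tuple_support_def by (simp add: sum.Sigma case_prod_unfold)
  also have "\<dots> = (\<Sum>b\<in>S. lookup (lookup w (fst b)) (snd b) * c b)"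
  proof (rule sum.mono_neutral_left[OF assms])
    show "\<forall>b\<in>S - tuple_support w. lookup (lookup w (fst b)) (snd b) * c b = 0"
      using in_tuple_support_iff[of "fst _" "snd _" w] by auto
  qed
  finally show ?thesis .
qed

lemma tuple_functional_eq:
  "tuple_functional c w = (\<Sum>b\<in>tuple_support w. lookup (lookup w (fst b)) (snd b) * c b)"
  by (rule tuple_functional_superset) (simp_all add: finite_tuple_support)

lemma tuple_functional_cong:
  "(\<And>b. b \<in> tuple_support w \<Longrightarrow> c b = c' b) \<Longrightarrow> tuple_functional c w = tuple_functional c' w"
  by (simp add: tuple_functional_eq)

lemma tuple_functional_linear: "Vector_Spaces.linear tuple_scale (*) (tuple_functional c)"
proof -
  have "tuple_functional c (u + v) = tuple_functional c u + tuple_functional c v" for u v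
  proof -
    let ?S = "tuple_support u \<union> tuple_support v"
    have "tuple_support (u + v) \<subseteq> ?S"
      by (auto simp: in_tuple_support_iff lookup_add)
    then show ?thesis
      by (simp add: tuple_functional_superset[of ?S] finite_tuple_support lookup_add distrib_right sum.distrib)
  qed
  moreover have "tuple_functional c (tuple_scale a v) = a * tuple_functional c v" for a v
  proof -
    have "tuple_support (tuple_scale a v) \<subseteq> tuple_support v"
      by (auto simp: in_tuple_support_iff)
    then show ?thesis
      by (simp add: tuple_functional_superset[of "tuple_support v"] finite_tuple_support sum_distrib_left mult_ac)
  qed
  moreover have "vector_space ((*) :: 'a \<Rightarrow> 'a \<Rightarrow> 'a)"
    by unfold_locales (simp_all add: algebra_simps)
  ultimately show ?thesis
    unfolding Vector_Spaces.linear_iff using tv.vector_space_axioms by blast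
qed

lemma tuple_expansion:
  "(\<Sum>b\<in>tuple_support w. tuple_scale (lookup (lookup w (fst b)) (snd b)) (single (fst b) (single (snd b) 1))) = w"
proof (intro poly_mapping_eqI)
  fix i js
  have "lookup (lookup (\<Sum>b\<in>tuple_support w. tuple_scale (lookup (lookup w (fst b)) (snd b))
      (single (fst b) (single (snd b) 1))) i) js =
    (\<Sum>b\<in>tuple_support w. if b = (i, js) then lookup (lookup w i) js else 0)"
    unfolding lookup_sum by (intro sum.cong refl) (auto simp: lookup_single when_def)
  also have "\<dots> = lookup (lookup w i) js"
    by (simp add: finite_tuple_support in_tuple_support_iff)
  finally show "lookup (lookup (\<Sum>b\<in>tuple_support w. tuple_scale (lookup (lookup w (fst b)) (snd b))
      (single (fst b) (single (snd b) 1))) i) js = lookup (lookup w i) js" .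
qed

lemma functional_eq_tuple_functional:
  assumes "Vector_Spaces.linear tuple_scale (*) \<psi>"
  shows "\<psi> w = tuple_functional (\<lambda>b. \<psi> (single (fst b) (single (snd b) 1))) w"
proof -
  interpret Vector_Spaces.linear tuple_scale "(*)" \<psi> by (rule assms)
  have "\<psi> w = \<psi> (\<Sum>b\<in>tuple_support w. tuple_scale (lookup (lookup w (fst b)) (snd b)) (single (fst b) (single (snd b) 1)))"
    by (simp only: tuple_expansion)
  then show ?thesis by (simp only: sum scale tuple_functional_eq)
qed

text \<open>
The value is affine in \<open>z\<close>, so a polynomial evaluated along a line in one coordinate direction is a univariate
polynomial in \<open>z\<close>.
\<close>

lemma tuple_functional_perturb:
  "tuple_functional (\<lambda>b. c b + (s(a := z)) b) w =
    tuple_functional (\<lambda>b. c b + (s(a := 0)) b) w + z * lookup (lookup w (fst a)) (snd a)"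
proof -
  let ?S = "insert a (tuple_support w)"
  have "tuple_functional (\<lambda>b. c b + (s(a := z)) b) w =
      (\<Sum>b\<in>?S. lookup (lookup w (fst b)) (snd b) * (c b + (s(a := 0)) b) +
        (if b = a then z * lookup (lookup w (fst a)) (snd a) else 0))"
    unfolding tuple_functional_superset[of ?S, OF finite.insertI[OF finite_tuple_support] subset_insertI]
    by (intro sum.cong refl) (simp add: algebra_simps)
  also have "\<dots> = tuple_functional (\<lambda>b. c b + (s(a := 0)) b) w + z * lookup (lookup w (fst a)) (snd a)"
    unfolding tuple_functional_superset[of ?S, OF finite.insertI[OF finite_tuple_support] subset_insertI]
    by (simp add: sum.distrib finite_tuple_support del: sum.insert)
  finally show ?thesis .
qed

section \<open>The universal functional\<close>

text \<open>
For every coordinate \<open>b = (i, js)\<close> of a tuple and every \<open>r\<close>, the indices \<open>block_index r b j\<close> form a private block of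
basis vectors of \<open>V\<close>, disjoint from all other blocks. The index \<open>r\<close> provides each block in infinitely many
copies, arbitrarily far out.
\<close>

definition block_index :: "nat \<Rightarrow> nat \<times> nat list \<Rightarrow> nat \<Rightarrow> nat" where
  "block_index r b j = prod_encode (r, to_nat (b, j))"

lemma block_index_eq_iff: "block_index r b j = block_index r' b' j' \<longleftrightarrow> r = r' \<and> b = b' \<and> j = j'"
  by (simp add: block_index_def)

lemma block_index_ge: "r \<le> block_index r b j"
  by (simp add: block_index_def le_prod_encode_1)

text \<open>
The functional that is supported on the blocks and restricts to the block of \<open>b = (i, js)\<close> as a copy of the
coordinate functional at \<open>b\<close>: it is \<open>1\<close> on the copy of the basis tensor \<open>e\<^bsub>js\<^esub>\<close> in component \<open>i\<close>.
\<close>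

definition universal_coeff :: "nat \<times> nat list \<Rightarrow> 'a::field" where
  "universal_coeff b = (if \<exists>r js. snd b = map (block_index r (fst b, js)) js then 1 else 0)"

text \<open>
Expand \<open>u e\<^bsub>js\<^esub>\<close> multilinearly into basis tensors \<open>e\<^bsub>ks\<^esub>\<close>. The functional sees \<open>e\<^bsub>ks\<^esub>\<close> only if all entries of \<open>ks\<close>
lie in one block. If one entry was moved into the block of some \<open>b\<close>, then none was left below \<open>n\<close>, so all
were moved there, and the positions within the block force \<open>b = (i, js)\<close>. So besides the unmoved tensor only
one term survives, and it carries one factor \<open>t b\<close> for each entry of \<open>js\<close>. For empty \<open>js\<close> the two terms would
coincide; this is where purity enters.
\<close>

lemma universal_coeff_unipotent:
  fixes t :: "nat \<times> nat list \<Rightarrow> 'a::field"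
  assumes B: "finite B"
    and u: "\<And>j. j < n \<Longrightarrow> u (single j 1) = single j 1 + (\<Sum>b\<in>B. single (block_index n b j) (t b))"
    and js: "js \<noteq> []" "\<And>j. j \<in> set js \<Longrightarrow> j < n" and iB: "(i, js) \<in> B"
  shows "tuple_functional universal_coeff (tuple_act u (single i (single js 1))) =
    universal_coeff (i, js) + t (i, js) ^ length js"
proof -
  define a where "a j l = lookup (u (single j 1)) l" for j l
  have a: "a j l = (if l = j then 1 else 0) + (\<Sum>b\<in>B. if l = block_index n b j then t b else 0)" if "j < n" for j l
    by (auto simp: a_def u[OF that] lookup_add lookup_sum lookup_single when_def intro!: sum.cong)
  have nth: "js ! k < n" if "k < length js" for k using js(2) that by simp
  let ?K = "map (block_index n (i, js)) js" and ?T = "tensor_map u (single js 1)"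
  have T: "lookup ?T ks = (if length ks = length js then \<Prod>k<length js. a (js ! k) (ks ! k) else 0)" for ks
    by (auto simp: tensor_map_single lookup_pure_tensor a_def intro!: prod.cong)
  define g where "g ks = lookup ?T ks * (universal_coeff (i, ks) :: 'a)" for ks
  have K_ne: "?K \<noteq> js"
  proof
    assume "?K = js"
    then have "block_index n (i, js) (js ! 0) = js ! 0" using js(1) nth_map[of 0 js "block_index n (i, js)"] by auto
    then show False using block_index_ge[of n "(i, js)" "js ! 0"] nth[of 0] js(1) by simp
  qed
  have zero: "g ks = 0" if "ks \<noteq> js" "ks \<noteq> ?K" for ks
  proof (rule ccontr)
    assume nz: "g ks \<noteq> 0"
    then have len: "length ks = length js" and fac: "\<And>k. k < length js \<Longrightarrow> a (js ! k) (ks ! k) \<noteq> 0"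
      by (auto simp: g_def T split: if_splits)
    obtain r js' where ks: "ks = map (block_index r (i, js')) js'"
      using nz by (auto simp: g_def universal_coeff_def split: if_splits)
    have cases: "ks ! k = js ! k \<or> (\<exists>b\<in>B. ks ! k = block_index n b (js ! k))" if "k < length js" for k
    proof (rule ccontr)
      assume "\<not> ?thesis"
      then have "a (js ! k) (ks ! k) = 0" using a[OF nth[OF that]] by (auto intro!: sum.neutral)
      then show False using fac[OF that] by simp
    qed
    have ksk: "ks ! k = block_index r (i, js') (js' ! k)" if "k < length js" for k
      using ks len that by simp
    obtain k0 where k0: "k0 < length js" "ks ! k0 \<noteq> js ! k0"
      using \<open>ks \<noteq> js\<close> len list_eq_iff_nth_eq[of ks js] by auto
    have r: "r = n"
      using cases[OF k0(1)] k0 ksk by (auto simp: block_index_eq_iff)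
    have "js' ! k = js ! k" if "k < length js" for k
    proof -
      have "ks ! k \<ge> n" using block_index_ge[of n "(i, js')"] ksk[OF that] r by simp
      then have "ks ! k \<noteq> js ! k" using nth[OF that] by simp
      then show ?thesis using cases[OF that] ksk[OF that] by (auto simp: block_index_eq_iff)
    qed
    then have "js' = js" using ks len by (intro nth_equalityI) auto
    then show False using ks r that(2) by simp
  qed
  have g_js: "g js = universal_coeff (i, js)"
  proof -
    have "a (js ! k) (js ! k) = 1" if "k < length js" for k
    proof -
      have "js ! k \<noteq> block_index n b (js ! k)" for b
        using block_index_ge[of n b "js ! k"] nth[OF that] by simp
      then show ?thesis by (simp add: a[OF nth[OF that]])
    qed
    then show ?thesis by (simp add: g_def T)
  qed
  have g_K: "g ?K = t (i, js) ^ length js"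
  proof -
    have "a (js ! k) (?K ! k) = t (i, js)" if "k < length js" for k
    proof -
      have "block_index n (i, js) (js ! k) \<noteq> js ! k"
        using block_index_ge[of n "(i, js)" "js ! k"] nth[OF that] by simp
      then show ?thesis using that B iB by (simp add: a[OF nth[OF that]] block_index_eq_iff)
    qed
    moreover have "universal_coeff (i, ?K) = (1 :: 'a)" by (auto simp: universal_coeff_def)
    ultimately show ?thesis by (simp add: g_def T)
  qed
  have "tuple_act u (single i (single js 1)) = single i ?T"
    by (rule poly_mapping_eqI) (simp add: lookup_single when_def vlinear_zero[OF vlinear_tensor_map])
  then have "tuple_functional universal_coeff (tuple_act u (single i (single js 1))) = (\<Sum>ks\<in>keys ?T. g ks)"
    by (auto simp: tuple_functional_def g_def)
  also have "\<dots> = (\<Sum>ks\<in>keys ?T \<union> {js, ?K}. g ks)"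
    by (rule sum.mono_neutral_left) (auto simp: g_def in_keys_iff)
  also have "\<dots> = (\<Sum>ks\<in>{js, ?K}. g ks)"
    by (rule sum.mono_neutral_right) (use zero in auto)
  also have "\<dots> = universal_coeff (i, js) + t (i, js) ^ length js"
    using K_ne by (simp add: g_js g_K)
  finally show ?thesis .
qed

section \<open>The orbit of the universal functional is dense\<close>

lemma GL_sym_algebra_action:
  "sym_algebra_action tuple_scale (tuple_rep lam) (tuple_act ` (GL :: ('a stdrep \<Rightarrow> 'a::field_char_0 stdrep) set))"
proof unfold_locales
  show "tv.subspace (tuple_rep lam)" by (rule subspace_tuple_rep)
next
  fix f :: "'a tuple_vec \<Rightarrow> 'a tuple_vec" assume "f \<in> tuple_act ` GL"
  then obtain g where g: "g \<in> GL" "f = tuple_act g" by blast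
  show "Vector_Spaces.linear tuple_scale tuple_scale f \<and> f ` tuple_rep lam \<subseteq> tuple_rep lam"
    using g tuple_act_linear tuple_act_rep by auto
  obtain g' where g': "g' \<in> GL" "\<And>v. g (g' v) = v" "\<And>v. g' (g v) = v"
    using GL_inverse[OF g(1)] by blast
  show "\<exists>f'\<in>tuple_act ` GL. (\<forall>w\<in>tuple_rep lam. f (f' w) = w) \<and> (\<forall>w\<in>tuple_rep lam. f' (f w) = w)"
    using g g' tuple_act_inverse[OF GL_vlinear[OF g(1)] g'(2)] tuple_act_inverse[OF GL_vlinear[OF g'(1)] g'(3)]
    by (intro bexI[of _ "tuple_act g'"]) auto
qed

lemma GL_generic_iff:
  "GL_generic lam x \<longleftrightarrow> generic (sym_alg tuple_scale (tuple_rep lam))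
    ((\<lambda>f. sym_map tuple_scale (tuple_rep lam) f) ` tuple_act ` GL) x"
  by (simp add: GL_generic_def coord_ring_def GL_action_def image_image)

text \<open>
Let \<open>\<psi>\<close> be a functional at which \<open>p\<close> does not vanish, and let \<open>B\<close> be the finite set of coordinates that
occur in the vectors of \<open>p\<close>. Up to the values of the universal functional itself, the unipotent elements that
spread \<open>e\<^sub>j\<close> over the blocks of \<open>B\<close> translate each coordinate \<open>b \<in> B\<close> independently by \<open>t b ^ d b\<close> with \<open>d b > 0\<close>.
Values of \<open>t\<close> with \<open>p\<close> nonzero exist, since \<open>p\<close> is nonzero at the translate \<open>\<psi>\<close>.
\<close>

lemma universal_orbit_dense:
  fixes p :: "('a tuple_vec, 'a::field_char_0) mpoly"
  assumes part: "\<forall>\<mu>\<in>set lam. is_partition \<mu>" and pure: "pure_tuple lam"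
    and p: "mpoly_vars p \<subseteq> tuple_rep lam" and nz: "p \<notin> sym_ideal tuple_scale (tuple_rep lam)"
  shows "\<exists>g\<in>GL. mpoly_eval (\<lambda>a. a) (tuple_functional universal_coeff \<circ> tuple_act g) p \<noteq> 0"
proof -
  interpret sym_algebra_action tuple_scale "tuple_rep lam" "tuple_act ` (GL :: ('a stdrep \<Rightarrow> 'a stdrep) set)"
    by (rule GL_sym_algebra_action)
  let ?c = "universal_coeff :: nat \<times> nat list \<Rightarrow> 'a"
  obtain \<psi> where \<psi>: "functional \<psi>" "ev \<psi> p \<noteq> 0"
    using functionals_separate[OF p nz] by blast
  define B where "B = (\<Union>w\<in>mpoly_vars p. tuple_support w)"
  have B: "finite B" by (simp add: B_def finite_mpoly_vars finite_tuple_support)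
  have support: "tuple_support w \<subseteq> B" if "w \<in> mpoly_vars p" for w using that by (auto simp: B_def)
  have nonempty: "snd b \<noteq> []" if "b \<in> B" for b
  proof -
    obtain w where w: "w \<in> mpoly_vars p" "b \<in> tuple_support w"
      using \<open>b \<in> B\<close> by (auto simp: B_def)
    obtain i js where b: "b = (i, js)" by (cases b)
    have k: "js \<in> keys (lookup w i)" using w(2) b by (simp add: in_tuple_support_iff in_keys_iff)
    have "lookup w i \<in> (if i < length lam then schur (lam ! i) else {0})"
      using subsetD[OF p w(1)] unfolding tuple_rep_def by blast
    then have i: "i < length lam" "lookup w i \<in> schur (lam ! i)" using k by (auto split: if_splits)
    have "length js = sum_list (lam ! i)" by (rule schur_length[OF i(2) k])
    moreover have "lam ! i \<noteq> []" "is_partition (lam ! i)"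
      using pure part i(1) by (auto simp: pure_tuple_def) (metis nth_mem)
    ultimately have "length js \<noteq> 0" by (cases "lam ! i") (auto simp: is_partition_def)
    then show ?thesis using b by simp
  qed
  \<comment> \<open>Blocks with first parameter \<open>n\<close> lie beyond all basis vectors occurring in \<open>p\<close>.\<close>
  define n where "n = Suc (Max (insert 0 (\<Union>b\<in>B. set (snd b))))"
  have n: "j < n" if "b \<in> B" "j \<in> set (snd b)" for b j
    unfolding n_def less_Suc_eq_le using B that by (intro Max_ge) auto
  define F where "F s = ev (tuple_functional (\<lambda>b. ?c b + s b)) p" for s
  define s where "s b = \<psi> (single (fst b) (single (snd b) 1)) - ?c b" for b
  have F_poly: "\<exists>Q. \<forall>z. F (s(a := z)) = poly Q z" for s a
  proof (intro exI allI)
    fix z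
    let ?x = "\<lambda>w. [:tuple_functional (\<lambda>b. ?c b + (s(a := 0)) b) w, lookup (lookup w (fst a)) (snd a):]"
    have "tuple_functional (\<lambda>b. ?c b + (s(a := z)) b) = (\<lambda>w. poly (?x w) z)"
      by (rule ext, rule trans[OF tuple_functional_perturb]) simp
    then show "F (s(a := z)) = poly (mpoly_eval (\<lambda>a. [:a:]) ?x p) z"
      by (simp only: F_def poly_mpoly_eval)
  qed
  have F_s: "F s \<noteq> 0"
  proof -
    have "tuple_functional (\<lambda>b. \<psi> (single (fst b) (single (snd b) 1))) = \<psi>"
      by (rule ext, rule sym, rule functional_eq_tuple_functional[OF \<psi>(1)])
    then show ?thesis using \<psi>(2) by (simp add: F_def s_def)
  qed
  have "\<exists>t. F (\<lambda>b. if b \<in> B then t b ^ length (snd b) else s b) \<noteq> 0"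
  proof (rule nonvanishing_at_powers[where F = F and d = "\<lambda>b. length (snd b)"])
    show "\<exists>Q. \<forall>z. F (s'(a := z)) = poly Q z" for s' a by (rule F_poly)
  qed (use nonempty in \<open>simp_all add: B F_s\<close>)
  then obtain t where t: "F (\<lambda>b. if b \<in> B then t b ^ length (snd b) else s b) \<noteq> 0" by blast
  define x where "x j = (\<Sum>b\<in>B. single (block_index n b j) (t b))" for j
  have "keys (x j) \<subseteq> {n..}" for j
  proof
    fix l assume "l \<in> keys (x j)"
    then have "(\<Sum>b\<in>B. lookup (single (block_index n b j) (t b)) l) \<noteq> 0" by (simp add: x_def in_keys_iff lookup_sum)
    then obtain b where "lookup (single (block_index n b j) (t b)) l \<noteq> 0" by (meson sum.neutral)
    then show "l \<in> {n..}" using block_index_ge[of n b j] by (auto simp: lookup_single when_def split: if_splits)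
  qed
  then obtain u where u: "u \<in> GL" "\<And>j. j < n \<Longrightarrow> u (single j 1) = single j 1 + x j"
    using unipotent_in_GL[of n x] by blast
  have "(tuple_functional ?c \<circ> tuple_act u) w =
      tuple_functional (\<lambda>b. ?c b + (if b \<in> B then t b ^ length (snd b) else s b)) w"
    if w: "w \<in> mpoly_vars p" for w
  proof -
    have "functional (tuple_functional ?c \<circ> tuple_act u)"
      using tuple_functional_linear tuple_act_linear Vector_Spaces.linear_compose by blast
    then have "(tuple_functional ?c \<circ> tuple_act u) w =
        tuple_functional (\<lambda>b. (tuple_functional ?c \<circ> tuple_act u) (single (fst b) (single (snd b) 1))) w"
      by (rule functional_eq_tuple_functional)
    also have "\<dots> = tuple_functional (\<lambda>b. ?c b + (if b \<in> B then t b ^ length (snd b) else s b)) w"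
    proof (rule tuple_functional_cong)
      fix b assume "b \<in> tuple_support w"
      then have "b \<in> B" using support[OF w] by blast
      moreover obtain i js where "b = (i, js)" by (cases b)
      ultimately show "(tuple_functional ?c \<circ> tuple_act u) (single (fst b) (single (snd b) 1)) =
          ?c b + (if b \<in> B then t b ^ length (snd b) else s b)"
        using universal_coeff_unipotent[OF B u(2)[unfolded x_def], of js i] nonempty[of b] n[of b] by auto
    qed
    finally show ?thesis .
  qed
  then have "ev (tuple_functional ?c \<circ> tuple_act u) p \<noteq> 0"
    using t unfolding F_def by (subst mpoly_eval_cong) auto
  then show ?thesis using u(1) by blast
qed

section \<open>Existence of generic points\<close>

theorem proposition3p13:
  fixes lam :: "nat list list"
  assumes "\<forall>\<mu>\<in>set lam. is_partition \<mu>"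
  shows "(\<exists>\<phi> :: 'a::field_char_0 tuple_fun \<Rightarrow> 'a.
           \<phi> \<in> K_points lam \<and> GL_generic lam (underlying_point lam \<phi>)) \<longleftrightarrow> pure_tuple lam"
proof -
  interpret sym_algebra_action tuple_scale "tuple_rep lam" "tuple_act ` (GL :: ('a stdrep \<Rightarrow> 'a stdrep) set)"
    by (rule GL_sym_algebra_action)
  show ?thesis
  proof
    assume pure: "pure_tuple lam"
    let ?\<phi> = "tuple_functional universal_coeff :: 'a tuple_vec \<Rightarrow> 'a"
    have "point ?\<phi> \<in> K_points lam"
      using point_hom[OF tuple_functional_linear] point_const[OF tuple_functional_linear]
      by (simp add: K_points_def coord_ring_def)
    moreover have "generic A \<Gamma> (a_kernel A ring_of_type_algebra (point ?\<phi>))"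
      using universal_orbit_dense[OF assms pure]
      by (intro generic_if_orbit_dense[OF tuple_functional_linear]) blast
    ultimately show "\<exists>\<phi> :: 'a tuple_fun \<Rightarrow> 'a. \<phi> \<in> K_points lam \<and> GL_generic lam (underlying_point lam \<phi>)"
      by (auto simp: GL_generic_iff underlying_point_def coord_ring_def)
  next
    assume "\<exists>\<phi> :: 'a tuple_fun \<Rightarrow> 'a. \<phi> \<in> K_points lam \<and> GL_generic lam (underlying_point lam \<phi>)"
    then obtain \<phi> :: "'a tuple_fun \<Rightarrow> 'a"
      where \<phi>: "\<phi> \<in> K_points lam" "GL_generic lam (underlying_point lam \<phi>)" by blast
    show "pure_tuple lam"
    proof (rule ccontr)
      assume "\<not> pure_tuple lam"
      then obtain i where i: "i < length lam" "lam ! i = []"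
        by (auto simp: pure_tuple_def in_set_conv_nth)
      let ?w = "single i (single [] 1) :: 'a tuple_vec"
      have "\<not> generic A \<Gamma> (a_kernel A ring_of_type_algebra \<phi>)"
      proof (rule not_generic_if_invariant_vector)
        show "?w \<in> tuple_rep lam"
          using i single_Nil_in_schur vs.subspace_0[OF subspace_schur]
          by (auto simp: tuple_rep_def lookup_single when_def)
        show "?w \<noteq> 0"
          by (metis lookup_single_eq lookup_zero one_neq_zero)
        show "f ?w = ?w" if "f \<in> tuple_act ` GL" for f
        proof -
          obtain g where g: "f = tuple_act g" using \<open>f \<in> tuple_act ` GL\<close> by blast
          have "tensor_map g (single [] 1) = single [] 1" by (simp add: tensor_map_single)
          then show ?thesis
            unfolding g by (intro poly_mapping_eqI)
              (simp add: lookup_single when_def vlinear_zero[OF vlinear_tensor_map])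
        qed
      qed (use \<phi>(1) in \<open>auto simp: K_points_def coord_ring_def\<close>)
      then show False
        using \<phi>(2) by (simp add: GL_generic_iff underlying_point_def coord_ring_def)
    qed
  qed
qed

end
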